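(* Let $r\ge 2$ and let $F=K_{a_1,\ldots,a_r}$ with $a_1\ge a_2\ge\cdots\ge a_r\ge 1$. If $a_{r-1}>1$, then there exists $t=t(F)$ such that for all $k>t$, $i_k(F)$, and hence also $i(F)$, is attained by a complete $t$-partite graphon. In particular, $F$ is not inducibility diverse.
   Context: All graphs are finite and simple. $K_{a_1,\ldots,a_r}$ is the complete $r$-partite graph with part sizes $a_1,\ldots,a_r$. For graphs $F,G$, $P(F,G)$ is the number of $|V(F)|$-subsets of $V(G)$ inducing a subgraph isomorphic to $F$, and $p(F,G)=P(F,G)/\binom{|V(G)|}{|V(F)|}$. $i(F,n)$ is the maximum of $p(F,G)$ over all $n$-vertex graphs $G$, and, for $k\ge 2$, $i_k(F,n)$ is the maximum over all $n$-vertex graphs not containing $K_k$ as a subgraph; $i(F)=\lim_{n\to\infty}i(F,n)$ and $i_k(F)=\lim_{n\to\infty}i_k(F,n)$ (the limits exist). $F$ is inducibility diverse if for every $k\ge 2$ there exists $m>k$ such that $i_k(F)<i_m(F)$. For $x_1,\ldots,x_\ell>0$ with $\sum x_i=1$, the complete $\ell$-partite graphon $W[x_1,\ldots,x_\ell]:[0,1]^2\to\{0,1\}$ is obtained by partitioning $[0,1]$ into intervals of lengths $x_1,\ldots,x_\ell$ and setting $W(x,y)=1$ iff $x,y$ lie in distinct intervals. The induced density of $F$ in $W$ is the probability that $|V(F)|$ independent uniform points of $[0,1]$ induce a copy of $F$, where distinct $u,v$ are adjacent iff $W(u,v)=1$. $i_k(F)$ (respectively $i(F)$) is attained by $W$ if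 the induced density of $F$ in $W$ equals $i_k(F)$ (respectively $i(F)$). *)

theory Defs
  imports "HOL-Analysis.Analysis" "Graph_Theory.Graph_Theory"
begin

text \<open>
  A finite simple graph is a \<open>pair_graph\<close>: a finite, loop-free, symmetric digraph whose arcs are
  pairs of vertices, so each edge \<open>uv\<close> is represented by the two arcs \<open>(u, v)\<close> and \<open>(v, u)\<close>.
\<close>

section \<open>Complete multipartite graphs\<close>

text \<open>The vertices of part \<open>i\<close> are \<open>(i, 1), \<dots>, (i, a i)\<close>.\<close>

definition complete_multipartite :: "nat \<Rightarrow> (nat \<Rightarrow> nat) \<Rightarrow> (nat \<times> nat) pair_pre_digraph" where
  "complete_multipartite r a =
     (let V = (SIGMA i:{1..r}. {1..a i})
      in \<lparr> pverts = V, parcs = {(u, v). u \<in> V \<and> v \<in> V \<and> fst u \<noteq> fst v} \<rparr>)"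

section \<open>Induced densities and inducibility\<close>

definition ind_count :: "'f pair_pre_digraph \<Rightarrow> 'a pair_pre_digraph \<Rightarrow> nat" where
  "ind_count F G =
     card {S. S \<subseteq> pverts G \<and> card S = card (pverts F)
              \<and> digraph_iso (with_proj G \<restriction> S) (with_proj F)}"

definition ind_density :: "'f pair_pre_digraph \<Rightarrow> 'a pair_pre_digraph \<Rightarrow> real" where
  "ind_density F G =
     real (ind_count F G) / real (card (pverts G) choose card (pverts F))"

definition clique_free :: "nat \<Rightarrow> 'a pair_pre_digraph \<Rightarrow> bool" where
  "clique_free k G \<longleftrightarrow> \<not> (\<exists>H. subgraph H (with_proj G) \<and> complete_digraph k H)"

text \<open>
  Host graphs have natural numbers as vertices, which covers all finite graphs up to isomorphism.
\<close>

definition max_density :: "'f pair_pre_digraph \<Rightarrow> nat \<Rightarrow> real" where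
  "max_density F n =
     Max {ind_density F G | G :: nat pair_pre_digraph. pair_graph G \<and> card (pverts G) = n}"

definition max_density_free :: "nat \<Rightarrow> 'f pair_pre_digraph \<Rightarrow> nat \<Rightarrow> real" where
  "max_density_free k F n =
     Max {ind_density F G | G :: nat pair_pre_digraph.
            pair_graph G \<and> card (pverts G) = n \<and> clique_free k G}"

definition inducibility :: "'f pair_pre_digraph \<Rightarrow> real" where
  "inducibility F = lim (\<lambda>n. max_density F n)"

definition inducibility_free :: "nat \<Rightarrow> 'f pair_pre_digraph \<Rightarrow> real" where
  "inducibility_free k F = lim (\<lambda>n. max_density_free k F n)"

definition inducibility_diverse :: "'f pair_pre_digraph \<Rightarrow> bool" where
  "inducibility_diverse F \<longleftrightarrow>
     (\<forall>k\<ge>2. \<exists>m>k. inducibility_free k F < inducibility_free m F)"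

section \<open>Complete partite graphons\<close>

text \<open>
  The \<open>i\<close>-th of the consecutive intervals of lengths \<open>x 1, \<dots>, x l\<close>. They are closed on the left
  and open on the right, except that the last one is closed, so that they partition \<open>[0, 1]\<close>.
\<close>

definition graphon_part :: "nat \<Rightarrow> (nat \<Rightarrow> real) \<Rightarrow> nat \<Rightarrow> real set" where
  "graphon_part l x i =
     (if i = l then {sum x {1..<i} .. sum x {1..i}} else {sum x {1..<i} ..< sum x {1..i}})"

definition partite_weights :: "nat \<Rightarrow> (nat \<Rightarrow> real) \<Rightarrow> bool" where
  "partite_weights l x \<longleftrightarrow> (\<forall>i\<in>{1..l}. 0 < x i) \<and> (\<Sum>i=1..l. x i) = 1"

text \<open>Only the values of a graphon on the unit square matter.\<close>

definition partite_graphon :: "nat \<Rightarrow> (nat \<Rightarrow> real) \<Rightarrow> real \<Rightarrow> real \<Rightarrow> real" where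
  "partite_graphon l x u v =
     (if \<exists>i\<in>{1..l}. \<exists>j\<in>{1..l}. i \<noteq> j \<and> u \<in> graphon_part l x i \<and> v \<in> graphon_part l x j
      then 1 else 0)"

text \<open>
  The graph induced by points \<open>u 0, \<dots>, u (n - 1)\<close> has the indices as its vertices; the points
  themselves are almost surely distinct.
\<close>

definition sample_graph ::
    "(real \<Rightarrow> real \<Rightarrow> real) \<Rightarrow> nat \<Rightarrow> (nat \<Rightarrow> real) \<Rightarrow> nat pair_pre_digraph" where
  "sample_graph W n u =
     \<lparr> pverts = {..<n}, parcs = {(i, j). i < n \<and> j < n \<and> i \<noteq> j \<and> W (u i) (u j) = 1} \<rparr>"

definition graphon_ind_density :: "'f pair_pre_digraph \<Rightarrow> (real \<Rightarrow> real \<Rightarrow> real) \<Rightarrow> real" where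
  "graphon_ind_density F W =
     (let n = card (pverts F); M = Pi\<^sub>M {..<n} (\<lambda>_. uniform_measure lborel {0..1::real})
      in measure M {u \<in> space M. digraph_iso (with_proj (sample_graph W n u)) (with_proj F)})"

definition attained_by_complete_partite :: "real \<Rightarrow> 'f pair_pre_digraph \<Rightarrow> nat \<Rightarrow> bool" where
  "attained_by_complete_partite c F t \<longleftrightarrow>
     (\<exists>x. partite_weights t x \<and> graphon_ind_density F (partite_graphon t x) = c)"

section \<open>Well-definedness\<close>

lemma pair_graph_complete_multipartite: "pair_graph (complete_multipartite r a)"
proof -
  have fin: "finite (SIGMA i:{1..r}. {1..a i})" by auto
  have "finite (parcs (complete_multipartite r a))"
    by (rule finite_subset[OF _ finite_cartesian_product[OF fin fin]])
       (auto simp: complete_multipartite_def Let_def)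
  then show ?thesis
    by unfold_locales
       (auto simp: complete_multipartite_def Let_def symmetric_def intro!: symI)
qed

lemma finite_densities:
  "finite {ind_density F G | G :: nat pair_pre_digraph. pair_graph G \<and> card (pverts G) = n \<and> Q G}"
proof -
  have "ind_count F G \<le> 2 ^ n" if "pair_graph G" "card (pverts G) = n"
    for G :: "nat pair_pre_digraph"
  proof -
    have fin: "finite (pverts G)"
      using that(1) by (simp add: pair_graph_def pair_digraph_def pair_fin_digraph.pair_finite_verts)
    then have "ind_count F G \<le> card (Pow (pverts G))"
      unfolding ind_count_def by (intro card_mono) auto
    then show ?thesis using that fin by (simp add: card_Pow)
  qed
  then have "{ind_density F G | G :: nat pair_pre_digraph. pair_graph G \<and> card (pverts G) = n \<and> Q G}
      \<subseteq> (\<lambda>c. real c / real (n choose card (pverts F))) ` {..2 ^ n}"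
    by (auto simp: ind_density_def)
  then show ?thesis by (rule finite_subset) simp
qed

lemma ex_clique_free:
  assumes "k \<ge> 2"
  shows "\<exists>G :: nat pair_pre_digraph. pair_graph G \<and> card (pverts G) = n \<and> clique_free k G"
proof -
  define G :: "nat pair_pre_digraph" where "G = \<lparr> pverts = {..<n}, parcs = {} \<rparr>"
  have "pair_graph G"
    by unfold_locales (auto simp: G_def symmetric_def intro!: symI)
  moreover have "clique_free k G"
    unfolding clique_free_def
  proof clarify
    fix H assume sub: "subgraph H (with_proj G)" and cl: "complete_digraph k H"
    from sub have "arcs H = {}" by (auto simp: subgraph_def G_def)
    then have no_arcs: "arcs_ends H = {}" by (simp add: arcs_ends_def)
    from cl have card_H: "card (verts H) = k"
      and ends: "arcs_ends H = {(u, v). (u, v) \<in> verts H \<times> verts H \<and> u \<noteq> v}"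
      by (auto simp: complete_digraph_def)
    from no_arcs ends have eq: "\<And>u v. u \<in> verts H \<Longrightarrow> v \<in> verts H \<Longrightarrow> u = v" by auto
    then have "card (verts H) \<le> 1"
      by (metis card_eq_0_iff card_le_Suc0_iff_eq One_nat_def zero_le_one)
    with card_H assms show False by simp
  qed
  ultimately show ?thesis by (intro exI[of _ G]) (simp add: G_def)
qed

end

theory Submission
  imports Defs "HOL-Probability.Probability" "HOL-Real_Asymp.Real_Asymp"
begin

text \<open>
  The maximum densities are squeezed between an upper bound valid for every host graph
  and a lower bound from complete \<open>t\<close>-partite hosts, both with the same limit. The limits of the
  densities with and without a forbidden clique then agree as soon as the clique has more than
  \<open>t\<close> vertices.

  Copies of \<open>F\<close> are counted by induced embeddings: \<open>card_embeddings\<close> says that these are the copies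
  multiplied by the number of automorphisms. Mapping the vertices of \<open>F\<close> at random into a complete
  multipartite host whose parts have relative sizes \<open>x\<close> preserves adjacency and non-adjacency
  exactly if each part of \<open>F\<close> goes into a single part of the host and distinct parts go into
  distinct ones, which has probability
  \<open>\<Sum>\<sigma>. \<Prod>q. x (\<sigma> q) ^ a q\<close> with \<open>\<sigma>\<close> ranging over the injections of parts. Denote this polynomial by
  \<open>P(x)\<close>.

  Upper bound: by Zykov symmetrization some complete multipartite graph on the same vertices
  has at least as many embeddings of \<open>F\<close> as a given host
  (\<open>ex_partite_graph_max_embeddings\<close>), so there are at most \<open>n ^ card (V F) * sup P\<close> of them.
  Lower bound: the expected number of embeddings into a random sample of \<open>n\<close> points of the
  \<open>t\<close>-partite graphon with part lengths \<open>x\<close> is \<open>P(x)\<close> times the number of injective maps, and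
  the sample is a complete multipartite graph with at most \<open>t\<close> parts
  (\<open>ex_sample_graph_many_embeddings\<close>). With \<open>card (V F)\<close> points the same
  expectation gives the induced density in the graphon.

  It remains to see that \<open>P\<close> attains its supremum over all finite weight vectors
  (\<open>labelled_density_attains_max\<close>), and here the hypothesis \<open>a (r - 1) > 1\<close> enters.
  Let \<open>s = a (r - 1)\<close>, so at most one part of \<open>F\<close> has fewer than \<open>s \<ge> 2\<close> vertices. Merge two
  parts with small weights \<open>y\<close> and \<open>z\<close>. The gain is at least a constant times
  \<open>(y + z)^s - y^s - z^s\<close>, hence at least a constant times \<open>z * y^(s-1) + z^(s-1) * y\<close>. The loss
  comes from maps using both parts, and each monomial \<open>y^u * z^v\<close> in it has
  \<open>u \<ge> s\<close> or \<open>v \<ge> s\<close>, so it is smaller by a factor of order \<open>max y z\<close>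
  (\<open>labelled_density_merge\<close>). Thus parts below a fixed threshold can be merged until a bounded
  number of parts is left, and on a simplex of bounded dimension compactness applies.
  If two parts of \<open>F\<close> were single vertices, the monomial \<open>y * z\<close> would also occur in the loss and
  the comparison would break down.
\<close>

section \<open>The density polynomial of a complete multipartite graph\<close>

definition injections :: "'a set \<Rightarrow> 'b set \<Rightarrow> ('a \<Rightarrow> 'b) set" where
  "injections R J = {\<sigma> \<in> R \<rightarrow>\<^sub>E J. inj_on \<sigma> R}"

text \<open>
  If \<open>R\<close> indexes the parts of a complete multipartite graph, with sizes \<open>a\<close>, and its vertices
  independently receive colours from \<open>J\<close> with distribution \<open>x\<close>, this is the probability that two
  vertices get the same colour exactly if they lie in the same part.
\<close>

definition labelled_density ::
    "('q \<Rightarrow> nat) \<Rightarrow> 'q set \<Rightarrow> 'j set \<Rightarrow> ('j \<Rightarrow> real) \<Rightarrow> real" where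
  "labelled_density a R J x = (\<Sum>\<sigma>\<in>injections R J. \<Prod>q\<in>R. x (\<sigma> q) ^ a q)"

lemma finite_injections: "finite R \<Longrightarrow> finite J \<Longrightarrow> finite (injections R J)"
  unfolding injections_def by (rule finite_subset[of _ "R \<rightarrow>\<^sub>E J"]) (auto intro: finite_PiE)

lemma labelled_density_empty [simp]: "labelled_density a {} J x = 1"
  by (simp add: labelled_density_def injections_def)

lemma labelled_density_nonneg:
  "(\<And>j. j \<in> J \<Longrightarrow> 0 \<le> x j) \<Longrightarrow> 0 \<le> labelled_density a R J x"
  unfolding labelled_density_def injections_def
  by (intro sum_nonneg prod_nonneg) (auto simp: PiE_iff)

lemma labelled_density_cong:
  assumes "\<And>j. j \<in> J \<Longrightarrow> x j = y j"
  shows "labelled_density a R J x = labelled_density a R J y"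
  unfolding labelled_density_def injections_def
  using assms by (intro sum.cong refl prod.cong) (auto simp: PiE_iff)

lemma labelled_density_mono_set:
  assumes "finite R" "finite J" "I \<subseteq> J" "\<And>j. j \<in> J \<Longrightarrow> 0 \<le> x j"
  shows "labelled_density a R I x \<le> labelled_density a R J x"
  unfolding labelled_density_def
proof (rule sum_mono2)
  show "finite (injections R J)" using assms finite_injections by blast
  show "injections R I \<subseteq> injections R J" using assms(3) by (auto simp: injections_def PiE_iff)
qed (use assms(4) in \<open>auto intro!: prod_nonneg simp: injections_def PiE_iff\<close>)

text \<open>
  An injection on \<open>insert q R\<close> consists of the value at \<open>q\<close> and an injection that avoids it.
\<close>

lemma labelled_density_insert_part:
  assumes "finite R" "finite J" "q \<notin> R"
  shows "labelled_density a (insert q R) J x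
    = (\<Sum>j\<in>J. x j ^ a q * labelled_density a R (J - {j}) x)"
proof -
  have "labelled_density a (insert q R) J x
      = (\<Sum>p\<in>(SIGMA j:J. injections R (J - {j})). \<Prod>q'\<in>insert q R. x (((snd p)(q := fst p)) q') ^ a q')"
    unfolding labelled_density_def
  proof (rule sum.reindex_bij_witness[where j = "\<lambda>\<sigma>. (\<sigma> q, restrict \<sigma> R)" and i = "\<lambda>p. (snd p)(q := fst p)"])
    fix \<sigma> assume s: "\<sigma> \<in> injections (insert q R) J"
    show eq: "(snd (\<sigma> q, restrict \<sigma> R))(q := fst (\<sigma> q, restrict \<sigma> R)) = \<sigma>"
      using s by (auto simp: injections_def PiE_iff extensional_def fun_eq_iff)
    show "(\<sigma> q, restrict \<sigma> R) \<in> (SIGMA j:J. injections R (J - {j}))"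
      using s \<open>q \<notin> R\<close> by (auto simp: injections_def PiE_iff inj_on_def)
    show "(\<Prod>q'\<in>insert q R. x (((snd (\<sigma> q, restrict \<sigma> R))(q := fst (\<sigma> q, restrict \<sigma> R))) q') ^ a q')
      = (\<Prod>q\<in>insert q R. x (\<sigma> q) ^ a q)"
      unfolding eq by simp
  next
    fix p assume "p \<in> (SIGMA j:J. injections R (J - {j}))"
    then obtain j \<tau> where p: "p = (j, \<tau>)" "j \<in> J" "\<tau> \<in> injections R (J - {j})" by auto
    have "\<tau> k \<noteq> j" if "k \<in> R" for k
      using p that by (auto simp: injections_def PiE_iff)
    then show "(snd p)(q := fst p) \<in> injections (insert q R) J"
      using p \<open>q \<notin> R\<close> by (auto simp: injections_def PiE_iff inj_on_def extensional_def)
    have "restrict (\<tau>(q := j)) R = \<tau>"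
      using p \<open>q \<notin> R\<close> by (auto simp: injections_def PiE_iff extensional_def fun_eq_iff)
    then show "(((snd p)(q := fst p)) q, restrict ((snd p)(q := fst p)) R) = p"
      using p by simp
  qed
  also have "\<dots> = (\<Sum>p\<in>(SIGMA j:J. injections R (J - {j})). x (fst p) ^ a q * (\<Prod>q'\<in>R. x (snd p q') ^ a q'))"
  proof (intro sum.cong refl)
    fix p :: "'b \<times> ('a \<Rightarrow> 'b)"
    have "(\<Prod>q'\<in>R. x (((snd p)(q := fst p)) q') ^ a q') = (\<Prod>q'\<in>R. x (snd p q') ^ a q')"
      using \<open>q \<notin> R\<close> by (intro prod.cong) auto
    then show "(\<Prod>q'\<in>insert q R. x (((snd p)(q := fst p)) q') ^ a q')
        = x (fst p) ^ a q * (\<Prod>q'\<in>R. x (snd p q') ^ a q')"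
      using assms by simp
  qed
  also have "\<dots> = (\<Sum>j\<in>J. x j ^ a q * labelled_density a R (J - {j}) x)"
    using assms by (subst sum.Sigma[symmetric, where g = "\<lambda>j \<tau>. x j ^ a q * (\<Prod>q'\<in>R. x (\<tau> q') ^ a q')", unfolded case_prod_unfold])
      (auto simp: finite_injections labelled_density_def sum_distrib_left)
  finally show ?thesis .
qed

text \<open>
  An injection either misses the new colour or takes it at exactly one part \<open>q\<close>. This is the
  expansion in the weight of a single colour on which the merging argument rests.
\<close>

lemma labelled_density_insert_colour:
  assumes "finite R" "finite J" "j \<notin> J"
  shows "labelled_density a R (insert j J) x
    = labelled_density a R J x + (\<Sum>q\<in>R. x j ^ a q * labelled_density a (R - {q}) J x)"
proof -
  let ?P = "\<lambda>\<sigma>. \<Prod>q\<in>R. x (\<sigma> q) ^ a q"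
  let ?U = "{\<sigma> \<in> injections R (insert j J). j \<in> \<sigma> ` R}"
  have split: "injections R (insert j J) = injections R J \<union> ?U"
    using \<open>j \<notin> J\<close> by (auto simp: injections_def PiE_iff image_iff)
  have fin: "finite (injections R (insert j J))" using assms by (simp add: finite_injections)
  have "labelled_density a R (insert j J) x = (\<Sum>\<sigma>\<in>injections R J. ?P \<sigma>) + (\<Sum>\<sigma>\<in>?U. ?P \<sigma>)"
    unfolding labelled_density_def
    by (subst split, rule sum.union_disjoint)
       (use assms fin in \<open>auto simp: finite_injections, auto simp: injections_def PiE_iff\<close>)
  also have "(\<Sum>\<sigma>\<in>?U. ?P \<sigma>)
      = (\<Sum>p\<in>(SIGMA q:R. injections (R - {q}) J). ?P ((snd p)(fst p := j)))"
  proof (rule sum.reindex_bij_witness[where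
        j = "\<lambda>\<sigma>. (the_inv_into R \<sigma> j, restrict \<sigma> (R - {the_inv_into R \<sigma> j}))"
        and i = "\<lambda>p. (snd p)(fst p := j)"])
    fix \<sigma> assume s: "\<sigma> \<in> ?U"
    let ?q = "the_inv_into R \<sigma> j"
    have q: "?q \<in> R" "\<sigma> ?q = j"
      using s by (auto simp: injections_def the_inv_into_into f_the_inv_into_f)
    show eq: "(snd (?q, restrict \<sigma> (R - {?q})))(fst (?q, restrict \<sigma> (R - {?q})) := j) = \<sigma>"
      using s q by (auto simp: injections_def PiE_iff extensional_def fun_eq_iff)
    have "\<sigma> k \<in> J" if "k \<in> R" "k \<noteq> ?q" for k
      using s q that by (metis (no_types, lifting) PiE_mem inj_on_eq_iff injections_def insertE mem_Collect_eq)
    then show "(?q, restrict \<sigma> (R - {?q})) \<in> (SIGMA q:R. injections (R - {q}) J)"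
      using s q by (auto simp: injections_def PiE_iff inj_on_def)
    show "?P ((snd (?q, restrict \<sigma> (R - {?q})))(fst (?q, restrict \<sigma> (R - {?q})) := j)) = ?P \<sigma>"
      unfolding eq by simp
  next
    fix p assume "p \<in> (SIGMA q:R. injections (R - {q}) J)"
    then obtain q \<tau> where p: "p = (q, \<tau>)" "q \<in> R" "\<tau> \<in> injections (R - {q}) J" by auto
    let ?s = "\<tau>(q := j)"
    have nj: "\<tau> k \<noteq> j" "\<tau> k \<in> J" if "k \<in> R" "k \<noteq> q" for k
      using p that \<open>j \<notin> J\<close> by (auto simp: injections_def PiE_iff)
    have inj: "inj_on ?s R"
      using p nj by (auto simp: injections_def inj_on_def)
    then show "(snd p)(fst p := j) \<in> ?U"
      using p nj by (auto simp: injections_def PiE_iff extensional_def)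
    have "the_inv_into R ?s j = q"
      using the_inv_into_f_f[OF inj p(2)] by simp
    moreover have "restrict ?s (R - {q}) = \<tau>"
      using p by (auto simp: injections_def PiE_iff extensional_def fun_eq_iff)
    ultimately show "(the_inv_into R ((snd p)(fst p := j)) j,
        restrict ((snd p)(fst p := j)) (R - {the_inv_into R ((snd p)(fst p := j)) j})) = p"
      using p by simp
  qed
  also have "\<dots> = (\<Sum>p\<in>(SIGMA q:R. injections (R - {q}) J).
      x j ^ a (fst p) * (\<Prod>q'\<in>R - {fst p}. x (snd p q') ^ a q'))"
    using assms by (intro sum.cong refl) (auto simp: prod.remove intro!: prod.cong)
  also have "\<dots> = (\<Sum>q\<in>R. x j ^ a q * labelled_density a (R - {q}) J x)"
    using assms by (subst sum.Sigma[symmetric,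
        where g = "\<lambda>q \<tau>. x j ^ a q * (\<Prod>q'\<in>R - {q}. x (\<tau> q') ^ a q')", unfolded case_prod_unfold])
      (auto simp: finite_injections labelled_density_def sum_distrib_left)
  finally show ?thesis by (simp add: labelled_density_def)
qed

text \<open>
  Giving \<open>q\<close> the colour \<open>j\<close> costs a factor \<open>x j ^ a q \<le> x j\<close>, and these factors sum to at most \<open>1\<close>.
\<close>

lemma labelled_density_le_remove:
  assumes "finite R" "finite J" "q \<in> R" "1 \<le> a q"
    and nonneg: "\<And>j. j \<in> J \<Longrightarrow> 0 \<le> x j" and total: "(\<Sum>j\<in>J. x j) \<le> 1"
  shows "labelled_density a R J x \<le> labelled_density a (R - {q}) J x"
proof -
  have le1: "x j \<le> 1" if "j \<in> J" for j
    using member_le_sum[OF that, of x] nonneg assms(2) total by force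
  have "labelled_density a R J x = (\<Sum>j\<in>J. x j ^ a q * labelled_density a (R - {q}) (J - {j}) x)"
    using labelled_density_insert_part[of "R - {q}" J q a x] assms by (simp add: insert_absorb)
  also have "\<dots> \<le> (\<Sum>j\<in>J. x j * labelled_density a (R - {q}) J x)"
  proof (rule sum_mono, rule mult_mono)
    fix j assume j: "j \<in> J"
    show "x j ^ a q \<le> x j"
      using power_decreasing[OF assms(4), of "x j"] nonneg[OF j] le1[OF j] by simp
    show "labelled_density a (R - {q}) (J - {j}) x \<le> labelled_density a (R - {q}) J x"
      using assms by (intro labelled_density_mono_set) auto
  qed (use nonneg in \<open>auto intro: labelled_density_nonneg\<close>)
  also have "\<dots> = (\<Sum>j\<in>J. x j) * labelled_density a (R - {q}) J x"
    by (simp add: sum_distrib_right)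
  also have "\<dots> \<le> 1 * labelled_density a (R - {q}) J x"
    using total nonneg by (intro mult_right_mono labelled_density_nonneg) auto
  finally show ?thesis by simp
qed

lemma labelled_density_le_1:
  assumes "finite R" "finite J" "\<And>q. q \<in> R \<Longrightarrow> 1 \<le> a q"
    and "\<And>j. j \<in> J \<Longrightarrow> 0 \<le> x j" and "(\<Sum>j\<in>J. x j) \<le> 1"
  shows "labelled_density a R J x \<le> 1"
  using assms(1,3)
proof (induction R rule: finite_induct)
  case (insert q R)
  have "labelled_density a (insert q R) J x \<le> labelled_density a (insert q R - {q}) J x"
    using insert assms by (intro labelled_density_le_remove) auto
  also have "\<dots> = labelled_density a R J x" using insert(2) by simp
  also have "\<dots> \<le> 1" using insert by simp
  finally show ?case .
qed simp

lemma labelled_density_reindex: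
  assumes "bij_betw g I J"
  shows "labelled_density a R I (x \<circ> g) = labelled_density a R J x"
  unfolding labelled_density_def
proof (rule sum.reindex_bij_witness[where j = "\<lambda>\<sigma>. restrict (g \<circ> \<sigma>) R"
        and i = "\<lambda>\<sigma>. restrict (the_inv_into I g \<circ> \<sigma>) R"])
  have inj: "inj_on g I" and im: "g ` I = J" using assms by (auto simp: bij_betw_def)
  {
    fix \<sigma> assume s: "\<sigma> \<in> injections R I"
    then have mem: "\<And>q. q \<in> R \<Longrightarrow> \<sigma> q \<in> I" by (auto simp: injections_def PiE_iff)
    show "restrict (the_inv_into I g \<circ> restrict (g \<circ> \<sigma>) R) R = \<sigma>"
      using s mem the_inv_into_f_f[OF inj]
      by (auto simp: injections_def PiE_iff extensional_def fun_eq_iff)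
    show "restrict (g \<circ> \<sigma>) R \<in> injections R J"
      using s mem inj im by (auto simp: injections_def inj_on_def)
    show "(\<Prod>q\<in>R. x (restrict (g \<circ> \<sigma>) R q) ^ a q) = (\<Prod>q\<in>R. (x \<circ> g) (\<sigma> q) ^ a q)"
      by simp
  next
    fix \<sigma> assume s: "\<sigma> \<in> injections R J"
    then have mem: "\<And>q. q \<in> R \<Longrightarrow> \<sigma> q \<in> g ` I" using im by (auto simp: injections_def PiE_iff)
    show "restrict (g \<circ> restrict (the_inv_into I g \<circ> \<sigma>) R) R = \<sigma>"
      using s mem f_the_inv_into_f[OF inj]
      by (auto simp: injections_def PiE_iff extensional_def fun_eq_iff)
    show "restrict (the_inv_into I g \<circ> \<sigma>) R \<in> injections R I"
    proof -
      have "inj_on (the_inv_into I g \<circ> \<sigma>) R"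
        using s mem
        by (intro comp_inj_on inj_on_subset[OF inj_on_the_inv_into[OF inj]])
           (auto simp: injections_def)
      then show ?thesis
        using mem the_inv_into_into[OF inj _ subset_refl]
        by (auto simp: injections_def inj_on_def)
    qed
  }
qed

section \<open>The maximum of the density polynomial\<close>

lemma labelled_density_support:
  assumes "finite R" "finite J" "I \<subseteq> J" "\<And>q. q \<in> R \<Longrightarrow> 1 \<le> a q" "\<And>j. j \<in> J - I \<Longrightarrow> x j = 0"
  shows "labelled_density a R J x = labelled_density a R I x"
  unfolding labelled_density_def
proof (rule sum.mono_neutral_right)
  show "finite (injections R J)" using assms by (simp add: finite_injections)
  show "injections R I \<subseteq> injections R J" using assms(3) by (auto simp: injections_def PiE_iff)
  show "\<forall>\<sigma>\<in>injections R J - injections R I. (\<Prod>q\<in>R. x (\<sigma> q) ^ a q) = 0"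
  proof
    fix \<sigma> assume "\<sigma> \<in> injections R J - injections R I"
    then obtain q where q: "q \<in> R" "\<sigma> q \<in> J - I" by (auto simp: injections_def PiE_iff)
    then have "x (\<sigma> q) ^ a q = 0" using assms(4)[OF q(1)] assms(5)[OF q(2)] by simp
    then show "(\<Prod>q\<in>R. x (\<sigma> q) ^ a q) = 0" using q(1) by (intro prod_zero[OF assms(1)]) blast
  qed
qed

lemma power_add_ge_sum_powers:
  fixes y z :: real
  assumes "0 \<le> y" "0 \<le> z" "1 \<le> n"
  shows "y ^ n + z ^ n \<le> (y + z) ^ n"
  using assms(3)
proof (induction n rule: dec_induct)
  case (step n)
  have "y ^ Suc n + z ^ Suc n \<le> (y + z) * (y ^ n + z ^ n)"
    using assms by (simp add: algebra_simps)
  also have "\<dots> \<le> (y + z) * (y + z) ^ n" using step assms by (intro mult_left_mono) auto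
  finally show ?case by simp
qed simp

lemma power_add_gain:
  fixes y z :: real
  assumes "0 \<le> y" "0 \<le> z" "2 \<le> s"
  shows "y ^ s + z ^ s + (z * y ^ (s - 1) + z ^ (s - 1) * y) \<le> (y + z) ^ s"
proof -
  obtain n where n: "s = Suc n" "1 \<le> n" using assms(3) by (cases s) auto
  have "y ^ s + z ^ s + (z * y ^ (s - 1) + z ^ (s - 1) * y) = (y + z) * (y ^ n + z ^ n)"
    using n by (simp add: algebra_simps)
  also have "\<dots> \<le> (y + z) * (y + z) ^ n"
    using power_add_ge_sum_powers[OF assms(1,2) n(2)] assms by (intro mult_left_mono) auto
  finally show ?thesis using n by simp
qed

lemma mixed_power_le_gain:
  fixes y z d :: real
  assumes "0 \<le> y" "0 \<le> z" "y \<le> d" "z \<le> d" "d \<le> 1" "2 \<le> s" "1 \<le> u" "1 \<le> v" "s \<le> u \<or> s \<le> v"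
  shows "y ^ u * z ^ v \<le> d * (z * y ^ (s - 1) + z ^ (s - 1) * y)"
proof -
  have *: "b ^ u' * c ^ v' \<le> d * (c * b ^ (s - 1))"
    if "0 \<le> b" "b \<le> d" "0 \<le> c" "c \<le> d" "s \<le> u'" "1 \<le> v'" for b c :: real and u' v'
  proof -
    have "b ^ u' * c ^ v' \<le> b ^ s * c ^ 1"
      using that assms by (intro mult_mono power_decreasing) auto
    also have "\<dots> = b * (c * b ^ (s - 1))" using assms(6) by (cases s) auto
    also have "\<dots> \<le> d * (c * b ^ (s - 1))" using that by (intro mult_right_mono) auto
    finally show ?thesis .
  qed
  have nn: "0 \<le> d * (z * y ^ (s - 1))" "0 \<le> d * (z ^ (s - 1) * y)" using assms by auto
  show ?thesis
    using assms(9)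
  proof
    assume su: "s \<le> u"
    show ?thesis
      unfolding distrib_left using *[OF assms(1,3,2,4) su assms(8)] nn by linarith
  next
    assume sv: "s \<le> v"
    have "y ^ u * z ^ v \<le> d * (z ^ (s - 1) * y)"
      using *[OF assms(2,4,1,3) sv assms(7)] by (simp only: mult.commute)
    then show ?thesis unfolding distrib_left using nn by linarith
  qed
qed

text \<open>
  As \<open>x i\<close> and \<open>x j\<close> are at most \<open>d\<close>, the injections that use \<open>i\<close> or \<open>j\<close> contribute a multiple
  of \<open>d\<close>, which the assumption \<open>big\<close> makes small against the density. What remains is the
  coefficient of the gain from the part \<open>p\<close>, and it is large enough to outweigh the losses.
\<close>

lemma labelled_density_merge:
  fixes x :: "'j \<Rightarrow> real" and d :: real
  assumes fin: "finite R" "finite J" and ij: "i \<in> J" "j \<in> J" "i \<noteq> j"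
    and a_pos: "\<And>q. q \<in> R \<Longrightarrow> 1 \<le> a q" and p: "p \<in> R" "2 \<le> a p"
    and a_min: "\<And>q q'. q \<in> R \<Longrightarrow> q' \<in> R \<Longrightarrow> q \<noteq> q' \<Longrightarrow> a p \<le> a q \<or> a p \<le> a q'"
    and x: "\<And>j. j \<in> J \<Longrightarrow> 0 \<le> x j" "(\<Sum>j\<in>J. x j) \<le> 1"
    and d: "x i \<le> d" "x j \<le> d" "d \<le> 1"
    and big: "(2 * real (card R) + real (card R) ^ 2) * d \<le> labelled_density a R J x"
  shows "labelled_density a R J x \<le> labelled_density a R (J - {j}) (x(i := x i + x j))"
proof -
  define I where "I = J - {i, j}"
  define y where "y = x j"
  define z where "z = x i"
  define s where "s = a p"
  define r where "r = real (card R)"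
  define g where "g = z * y ^ (s - 1) + z ^ (s - 1) * y"
  let ?L = "\<lambda>R J. labelled_density a R J x"
  have J: "J = insert j (insert i I)" "j \<notin> insert i I" "i \<notin> I" and finI: "finite I" "finite (insert i I)"
    using ij fin by (auto simp: I_def)
  have yz: "0 \<le> y" "0 \<le> z" "y \<le> d" "z \<le> d" using x ij d by (auto simp: y_def z_def)
  then have d0: "0 \<le> d" by linarith
  have g0: "0 \<le> g" using yz by (auto simp: g_def)
  have sub: "?L S K \<le> 1" "0 \<le> ?L S K" if "S \<subseteq> R" "K \<subseteq> J" for S K
  proof -
    have "(\<Sum>j\<in>K. x j) \<le> (\<Sum>j\<in>J. x j)" using that fin x by (intro sum_mono2) auto
    then show "?L S K \<le> 1" using that fin x a_pos
      by (intro labelled_density_le_1) (auto intro: finite_subset)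
    show "0 \<le> ?L S K" using that x by (intro labelled_density_nonneg) auto
  qed
  have IJ: "I \<subseteq> J" "insert i I \<subseteq> J" using J by auto
  have pow_le: "w ^ a q \<le> d" if "0 \<le> w" "w \<le> d" "q \<in> R" for w q
  proof -
    have "w ^ a q \<le> w ^ 1" using that a_pos d by (intro power_decreasing) auto
    then show ?thesis using that by simp
  qed
  \<comment> \<open>Both densities are expanded in the two small weights; the double sum, with both colours in use, is what merging destroys.\<close>
  have old: "?L R J = ?L R I + (\<Sum>q\<in>R. (z ^ a q + y ^ a q) * ?L (R - {q}) I)
      + (\<Sum>q\<in>R. \<Sum>q'\<in>R - {q}. y ^ a q * z ^ a q' * ?L (R - {q} - {q'}) I)"
  proof -
    have "?L R J = ?L R (insert i I) + (\<Sum>q\<in>R. y ^ a q * ?L (R - {q}) (insert i I))"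
      unfolding J(1) y_def using labelled_density_insert_colour[OF fin(1) finI(2) J(2)] .
    also have "?L R (insert i I) = ?L R I + (\<Sum>q\<in>R. z ^ a q * ?L (R - {q}) I)"
      unfolding z_def using labelled_density_insert_colour[OF fin(1) finI(1) J(3)] .
    also have "(\<Sum>q\<in>R. y ^ a q * ?L (R - {q}) (insert i I))
        = (\<Sum>q\<in>R. y ^ a q * ?L (R - {q}) I
            + (\<Sum>q'\<in>R - {q}. y ^ a q * z ^ a q' * ?L (R - {q} - {q'}) I))"
    proof (rule sum.cong[OF refl])
      fix q
      have "?L (R - {q}) (insert i I)
          = ?L (R - {q}) I + (\<Sum>q'\<in>R - {q}. z ^ a q' * ?L (R - {q} - {q'}) I)"
        unfolding z_def using fin by (intro labelled_density_insert_colour finI J(3)) auto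
      then show "y ^ a q * ?L (R - {q}) (insert i I) = y ^ a q * ?L (R - {q}) I
            + (\<Sum>q'\<in>R - {q}. y ^ a q * z ^ a q' * ?L (R - {q} - {q'}) I)"
        by (simp add: distrib_left sum_distrib_left mult.assoc)
    qed
    finally show ?thesis by (simp add: sum.distrib distrib_right)
  qed
  have new: "labelled_density a R (J - {j}) (x(i := x i + x j))
      = ?L R I + (\<Sum>q\<in>R. (y + z) ^ a q * ?L (R - {q}) I)"
  proof -
    have "J - {j} = insert i I" using J by auto
    then have "labelled_density a R (J - {j}) (x(i := x i + x j))
      = labelled_density a R I (x(i := x i + x j))
        + (\<Sum>q\<in>R. (x(i := x i + x j)) i ^ a q * labelled_density a (R - {q}) I (x(i := x i + x j)))"
      by (simp only: labelled_density_insert_colour[OF fin(1) finI(1) J(3)])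
    moreover have "labelled_density a S I (x(i := x i + x j)) = ?L S I" for S
      using J(3) by (intro labelled_density_cong) auto
    ultimately show ?thesis by (simp add: y_def z_def add.commute)
  qed
  \<comment> \<open>The factor in front of the gain of \<open>p\<close> inherits a lower bound from the density itself, because \<open>p\<close> can be dropped and the injections of the other parts that use a small colour carry little weight.\<close>
  have D: "?L R J - 2 * r * d \<le> ?L (R - {p}) I"
  proof -
    have bound: "(\<Sum>q\<in>R - {p}. w ^ a q * ?L (R - {p} - {q}) K) \<le> r * d"
      if "0 \<le> w" "w \<le> d" "K \<subseteq> J" for w K
    proof -
      have "w ^ a q * ?L (R - {p} - {q}) K \<le> d * 1" if "q \<in> R - {p}" for q
        using that \<open>0 \<le> w\<close> \<open>w \<le> d\<close> \<open>K \<subseteq> J\<close> d0 by (intro mult_mono pow_le sub) auto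
      then have "(\<Sum>q\<in>R - {p}. w ^ a q * ?L (R - {p} - {q}) K) \<le> (\<Sum>q\<in>R - {p}. d * 1)"
        by (rule sum_mono)
      also have "\<dots> \<le> r * d"
        unfolding r_def using d0 fin by (simp add: card_Diff1_le mult_right_mono)
      finally show ?thesis .
    qed
    have "?L R J \<le> ?L (R - {p}) J"
      using fin p a_pos x by (intro labelled_density_le_remove) auto
    also have "\<dots> = ?L (R - {p}) (insert i I)
        + (\<Sum>q\<in>R - {p}. y ^ a q * ?L (R - {p} - {q}) (insert i I))"
      unfolding J(1) y_def using fin by (intro labelled_density_insert_colour finI J(2)) auto
    also have "?L (R - {p}) (insert i I)
        = ?L (R - {p}) I + (\<Sum>q\<in>R - {p}. z ^ a q * ?L (R - {p} - {q}) I)"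
      unfolding z_def using fin by (intro labelled_density_insert_colour finI J(3)) auto
    finally show ?thesis
      using bound[of y "insert i I"] bound[of z I] yz IJ by linarith
  qed
  have gain: "g * ?L (R - {p}) I \<le> (\<Sum>q\<in>R. ((y + z) ^ a q - (z ^ a q + y ^ a q)) * ?L (R - {q}) I)"
  proof -
    have "g * ?L (R - {p}) I \<le> ((y + z) ^ a p - (z ^ a p + y ^ a p)) * ?L (R - {p}) I"
      using power_add_gain[OF yz(1,2) p(2)] sub(2)[of "R - {p}" I] IJ
      by (intro mult_right_mono) (auto simp: g_def s_def)
    also have "\<dots> \<le> (\<Sum>q\<in>R. ((y + z) ^ a q - (z ^ a q + y ^ a q)) * ?L (R - {q}) I)"
    proof (rule member_le_sum[OF p(1) _ fin(1)])
      fix q assume "q \<in> R - {p}"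
      then show "0 \<le> ((y + z) ^ a q - (z ^ a q + y ^ a q)) * ?L (R - {q}) I"
        using power_add_ge_sum_powers[OF yz(1,2), of "a q"] a_pos[of q] sub(2)[of "R - {q}" I] IJ
        by (intro mult_nonneg_nonneg) auto
    qed
    finally show ?thesis .
  qed
  have loss: "(\<Sum>q\<in>R. \<Sum>q'\<in>R - {q}. y ^ a q * z ^ a q' * ?L (R - {q} - {q'}) I) \<le> r\<^sup>2 * d * g"
  proof -
    have "y ^ a q * z ^ a q' * ?L (R - {q} - {q'}) I \<le> d * g" if "q \<in> R" "q' \<in> R - {q}" for q q'
    proof -
      have "y ^ a q * z ^ a q' * ?L (R - {q} - {q'}) I \<le> (d * g) * 1"
        unfolding g_def s_def using that IJ
        by (intro mult_mono mixed_power_le_gain sub p(2))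
           (use yz d a_pos a_min[of q q'] in auto)
      then show ?thesis by simp
    qed
    then have "(\<Sum>q\<in>R. \<Sum>q'\<in>R - {q}. y ^ a q * z ^ a q' * ?L (R - {q} - {q'}) I)
        \<le> (\<Sum>q\<in>R. \<Sum>q'\<in>R - {q}. d * g)"
      by (intro sum_mono) blast
    also have "\<dots> \<le> (\<Sum>q\<in>R. r * (d * g))"
      using d0 g0 fin by (intro sum_mono) (simp add: r_def card_Diff1_le mult_right_mono)
    finally show ?thesis by (simp add: r_def power2_eq_square algebra_simps)
  qed
  have "r\<^sup>2 * d * g \<le> g * ?L (R - {p}) I"
  proof -
    have "r\<^sup>2 * d \<le> ?L (R - {p}) I" using D big by (simp add: r_def algebra_simps)
    from mult_left_mono[OF this g0] show ?thesis by (simp add: algebra_simps)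
  qed
  with gain loss show ?thesis
    unfolding old new by (simp add: sum_subtractf left_diff_distrib)
qed

text \<open>
  Since the weights sum to \<open>1\<close> and \<open>T * d > 1\<close>, fewer than \<open>T\<close> of them exceed \<open>d\<close>. With more
  than \<open>T\<close> colours there are therefore two of weight at most \<open>d\<close>, which can be merged.
\<close>

lemma labelled_density_reduce:
  fixes x :: "'j \<Rightarrow> real" and d :: real
  assumes fin: "finite R" "finite J"
    and a_pos: "\<And>q. q \<in> R \<Longrightarrow> 1 \<le> a q" and p: "p \<in> R" "2 \<le> a p"
    and a_min: "\<And>q q'. q \<in> R \<Longrightarrow> q' \<in> R \<Longrightarrow> q \<noteq> q' \<Longrightarrow> a p \<le> a q \<or> a p \<le> a q'"
    and x: "\<And>j. j \<in> J \<Longrightarrow> 0 \<le> x j" "(\<Sum>j\<in>J. x j) = 1"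
    and d: "d \<le> 1" "1 < real T * d"
    and big: "(2 * real (card R) + real (card R) ^ 2) * d \<le> labelled_density a R J x"
  shows "\<exists>J' x'. J' \<subseteq> J \<and> card J' \<le> T \<and> (\<forall>j\<in>J'. 0 \<le> x' j) \<and> (\<Sum>j\<in>J'. x' j) = 1
           \<and> labelled_density a R J x \<le> labelled_density a R J' x'"
  using fin(2) x big
proof (induction "card J" arbitrary: J x rule: less_induct)
  case less
  show ?case
  proof (cases "card J \<le> T")
    case True
    then show ?thesis using less.prems by blast
  next
    case False
    have "0 < d"
      using d by (metis linorder_not_less mult_nonneg_nonpos of_nat_0_le_iff less_le_trans not_one_less_zero)
    have "\<not> card {j \<in> J. x j \<le> d} \<le> Suc 0"
    proof
      assume small: "card {j \<in> J. x j \<le> d} \<le> Suc 0"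
      have "card J = card {j \<in> J. x j \<le> d} + card {j \<in> J. \<not> x j \<le> d}"
        using less.prems(1) by (subst card_Un_disjoint[symmetric]) (auto intro: arg_cong[where f = card])
      then have "T \<le> card {j \<in> J. \<not> x j \<le> d}" using small False by linarith
      then have "real T * d \<le> real (card {j \<in> J. \<not> x j \<le> d}) * d"
        using \<open>0 < d\<close> by simp
      also have "\<dots> = (\<Sum>j\<in>{j \<in> J. \<not> x j \<le> d}. d)" by simp
      also have "\<dots> \<le> (\<Sum>j\<in>{j \<in> J. \<not> x j \<le> d}. x j)" by (intro sum_mono) auto
      also have "\<dots> \<le> (\<Sum>j\<in>J. x j)" using less.prems by (intro sum_mono2) auto
      finally show False using less.prems(3) d by simp
    qed
    then obtain i j where ij: "i \<in> J" "j \<in> J" "i \<noteq> j" "x i \<le> d" "x j \<le> d"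
      using less.prems(1) by (subst (asm) card_le_Suc0_iff_eq) auto
    define x' where "x' = x(i := x i + x j)"
    have le: "labelled_density a R J x \<le> labelled_density a R (J - {j}) x'"
      unfolding x'_def using less.prems ij d
      by (intro labelled_density_merge[where R = R and a = a and p = p and d = d and J = J,
            OF fin(1) less.prems(1) ij(1-3) a_pos p a_min]) auto
    have "(\<Sum>k\<in>J - {j}. x' k) = x' i + (\<Sum>k\<in>J - {j} - {i}. x' k)"
      using less.prems ij by (intro sum.remove) auto
    also have "\<dots> = x j + (x i + (\<Sum>k\<in>J - {j} - {i}. x k))"
      by (simp add: x'_def)
    also have "\<dots> = (\<Sum>k\<in>J. x k)"
      using less.prems ij sum.remove[of J j x] sum.remove[of "J - {j}" i x] by simp
    finally have sum1: "(\<Sum>k\<in>J - {j}. x' k) = 1" using less.prems by simp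
    have "\<exists>J' x''. J' \<subseteq> J - {j} \<and> card J' \<le> T \<and> (\<forall>j\<in>J'. 0 \<le> x'' j) \<and> (\<Sum>j\<in>J'. x'' j) = 1
           \<and> labelled_density a R (J - {j}) x' \<le> labelled_density a R J' x''"
    proof (rule less.hyps)
      show "card (J - {j}) < card J" using ij less.prems by (intro card_Diff1_less) auto
      show "0 \<le> x' k" if "k \<in> J - {j}" for k
        using that less.prems ij by (auto simp: x'_def)
    qed (use less.prems sum1 le in auto)
    then show ?thesis using le by (meson Diff_subset order_trans subset_trans)
  qed
qed

text \<open>
  The simplex is taken inside the compact product of \<open>[0, 1]\<close> over \<open>1, \<dots>, T\<close> and \<open>{0}\<close> elsewhere.
\<close>

lemma labelled_density_simplex_max:
  assumes "1 \<le> T"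
  shows "\<exists>x. (\<forall>j\<in>{1..T}. 0 \<le> x j) \<and> (\<Sum>j=1..T. x j) = 1 \<and>
    (\<forall>y :: nat \<Rightarrow> real. (\<forall>j\<in>{1..T}. 0 \<le> y j) \<longrightarrow> (\<Sum>j=1..T. y j) = 1 \<longrightarrow>
       labelled_density a R {1..T} y \<le> labelled_density a R {1..T} x)"
proof -
  define B :: "(nat \<Rightarrow> real) set" where "B = (\<Pi>\<^sub>E j\<in>UNIV. if j \<in> {1..T} then {0..1} else {0})"
  define C where "C = B \<inter> {x. (\<Sum>j=1..T. x j) = 1}"
  have "compactin (product_topology (\<lambda>_. euclidean) UNIV) B"
    unfolding B_def compactin_PiE by auto
  then have "compact B" by (simp add: euclidean_product_topology)
  moreover have "closed {x :: nat \<Rightarrow> real. (\<Sum>j=1..T. x j) = 1}"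
    by (intro closed_Collect_eq continuous_intros continuous_on_product_coordinates)
  ultimately have comp: "compact C" unfolding C_def by (rule compact_Int_closed)
  have inC: "(\<lambda>j. if j \<in> {1..T} then y j else 0) \<in> C"
    if "\<forall>j\<in>{1..T}. 0 \<le> y j" "(\<Sum>j=1..T. y j) = 1" for y
  proof -
    have "y j \<le> 1" if "j \<in> {1..T}" for j
      using member_le_sum[OF that, of y] \<open>\<forall>j\<in>{1..T}. 0 \<le> y j\<close> \<open>(\<Sum>j=1..T. y j) = 1\<close> by auto
    then show ?thesis using that by (auto simp: C_def B_def)
  qed
  have "(\<lambda>j. if j = 1 then 1 else (0::real)) \<in> C"
    using inC[of "\<lambda>j. if j = 1 then 1 else 0"] assms by (force simp: C_def B_def)
  then have ne: "C \<noteq> {}" by auto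
  have "continuous_on C (labelled_density a R {1..T})"
    unfolding labelled_density_def
    by (intro continuous_intros continuous_on_subset[OF continuous_on_product_coordinates]) auto
  from continuous_attains_sup[OF comp ne this] obtain x where
    x: "x \<in> C" "\<And>y. y \<in> C \<Longrightarrow> labelled_density a R {1..T} y \<le> labelled_density a R {1..T} x"
    by blast
  show ?thesis
  proof (intro exI[of _ x] conjI allI impI)
    show "\<forall>j\<in>{1..T}. 0 \<le> x j" "(\<Sum>j=1..T. x j) = 1"
      using x(1) by (auto simp: C_def B_def PiE_iff split: if_splits)
    fix y :: "nat \<Rightarrow> real" assume y: "\<forall>j\<in>{1..T}. 0 \<le> y j" "(\<Sum>j=1..T. y j) = 1"
    have "labelled_density a R {1..T} y
        = labelled_density a R {1..T} (\<lambda>j. if j \<in> {1..T} then y j else 0)"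
      by (rule labelled_density_cong) simp
    also have "\<dots> \<le> labelled_density a R {1..T} x" using x(2) inC[OF y] by blast
    finally show "labelled_density a R {1..T} y \<le> labelled_density a R {1..T} x" .
  qed
qed

text \<open>
  A weight vector is either beaten by the uniform one or has density bounded below, and in the
  second case merging reduces it to boundedly many colours. Dropping the colours of weight zero
  from a maximum on the simplex leaves positive weights.
\<close>

lemma labelled_density_attains_max:
  assumes fin: "finite R"
    and a_pos: "\<And>q. q \<in> R \<Longrightarrow> 1 \<le> a q" and p: "p \<in> R" "2 \<le> a p"
    and a_min: "\<And>q q'. q \<in> R \<Longrightarrow> q' \<in> R \<Longrightarrow> q \<noteq> q' \<Longrightarrow> a p \<le> a q \<or> a p \<le> a q'"
  shows "\<exists>t x. 1 \<le> t \<and> partite_weights t x \<and>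
    (\<forall>(J :: nat set) y. finite J \<longrightarrow> (\<forall>j\<in>J. 0 \<le> y j) \<longrightarrow> (\<Sum>j\<in>J. y j) = 1 \<longrightarrow>
       labelled_density a R J y \<le> labelled_density a R {1..t} x)"
proof -
  define m where "m = card R"
  define x0 :: "nat \<Rightarrow> real" where "x0 = (\<lambda>_. 1 / real m)"
  define P0 where "P0 = labelled_density a R {1..m} x0"
  have m: "1 \<le> m" using p fin by (auto simp: m_def Suc_le_eq card_gt_0_iff)
  have sum_x0: "(\<Sum>j=1..m. x0 j) = 1" using m by (simp add: x0_def)
  have "0 < P0"
  proof -
    obtain h where h: "bij_betw h R {1..m}"
      using finite_same_card_bij[OF fin, of "{1..m}"] unfolding m_def by fastforce
    have mem: "restrict h R \<in> injections R {1..m}"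
      using h by (auto simp: injections_def bij_betw_def inj_on_def)
    have pos: "0 < (\<Prod>q\<in>R. x0 (restrict h R q) ^ a q)"
      using m by (intro prod_pos) (auto simp: x0_def)
    have nonneg: "0 \<le> (\<Prod>q\<in>R. x0 (\<sigma> q) ^ a q)" for \<sigma>
      by (intro prod_nonneg) (auto simp: x0_def)
    show ?thesis
      unfolding P0_def labelled_density_def
      by (rule sum_pos2[where f = "\<lambda>\<sigma>. \<Prod>q\<in>R. x0 (\<sigma> q) ^ a q", OF finite_injections[OF fin finite_atLeastAtMost] mem pos nonneg])
  qed
  \<comment> \<open>The threshold below which \<open>labelled_density_merge\<close> applies to every vector of density at least \<open>P0\<close>.\<close>
  define d where "d = P0 / (2 * real m + real m ^ 2)"
  have den: "1 \<le> 2 * real m + real m ^ 2"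
    using m by (simp add: add_increasing2)
  have "P0 \<le> 1" unfolding P0_def using sum_x0 fin a_pos
    by (intro labelled_density_le_1) (auto simp: x0_def)
  then have "d \<le> 1" unfolding d_def using den by simp
  have "0 < d" unfolding d_def using \<open>0 < P0\<close> den by simp
  obtain n where n: "1 < real n * d" using reals_Archimedean3[OF \<open>0 < d\<close>] by blast
  define T where "T = max m n"
  have "real n * d \<le> real T * d" using \<open>0 < d\<close> by (simp add: T_def)
  then have T: "1 < real T * d" "1 \<le> T" "m \<le> T" using n m by (auto simp: T_def)
  obtain xm where xm: "\<forall>j\<in>{1..T}. 0 \<le> xm j" "(\<Sum>j=1..T. xm j) = 1"
    "\<And>y. \<forall>j\<in>{1..T}. 0 \<le> y j \<Longrightarrow> (\<Sum>j=1..T. y j) = 1 \<Longrightarrow>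
       labelled_density a R {1..T} y \<le> labelled_density a R {1..T} xm"
    using labelled_density_simplex_max[OF T(2)] by blast
  let ?M = "labelled_density a R {1..T} xm"
  have few: "labelled_density a R J y \<le> ?M"
    if J: "finite J" "card J \<le> T" "\<forall>j\<in>J. 0 \<le> y j" "(\<Sum>j\<in>J. y j) = 1" for J :: "nat set" and y
  proof -
    obtain g where g: "bij_betw g {1..card J} J"
      using ex_bij_betw_nat_finite_1[OF J(1)] by blast
    define y' where "y' = (\<lambda>i. if i \<le> card J then y (g i) else 0)"
    have mem: "g i \<in> J" if "i \<in> {1..card J}" for i using g that by (auto simp: bij_betw_def)
    have y': "\<forall>j\<in>{1..T}. 0 \<le> y' j" using J(3) mem by (auto simp: y'_def)
    have "(\<Sum>j=1..T. y' j) = (\<Sum>j=1..card J. y' j)"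
      using J(2) by (intro sum.mono_neutral_right) (auto simp: y'_def)
    also have "\<dots> = (\<Sum>j=1..card J. y (g j))" by (simp add: y'_def)
    also have "\<dots> = (\<Sum>j\<in>J. y j)" by (rule sum.reindex_bij_betw[OF g])
    finally have sum': "(\<Sum>j=1..T. y' j) = 1" using J by simp
    have "labelled_density a R J y = labelled_density a R {1..card J} (y \<circ> g)"
      by (rule labelled_density_reindex[OF g, symmetric])
    also have "\<dots> = labelled_density a R {1..card J} y'"
      by (rule labelled_density_cong) (simp add: y'_def)
    also have "\<dots> \<le> labelled_density a R {1..T} y'"
      using J(2) y' fin by (intro labelled_density_mono_set) auto
    also have "\<dots> \<le> ?M" using xm(3) y' sum' by blast
    finally show ?thesis .
  qed
  have all: "labelled_density a R J y \<le> ?M"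
    if J: "finite J" "\<forall>j\<in>J. 0 \<le> y j" "(\<Sum>j\<in>J. y j) = 1" for J :: "nat set" and y
  proof (cases "P0 \<le> labelled_density a R J y")
    case True
    have "\<exists>J' x'. J' \<subseteq> J \<and> card J' \<le> T \<and> (\<forall>j\<in>J'. 0 \<le> x' j) \<and> (\<Sum>j\<in>J'. x' j) = 1
           \<and> labelled_density a R J y \<le> labelled_density a R J' x'"
    proof (rule labelled_density_reduce[where R = R and a = a and p = p and d = d,
          OF fin J(1) a_pos p a_min])
      show "(2 * real (card R) + real (card R) ^ 2) * d \<le> labelled_density a R J y"
        using True den by (simp add: d_def m_def)
    qed (use J \<open>d \<le> 1\<close> T in auto)
    then show ?thesis using few finite_subset[OF _ J(1)] by (meson order_trans)
  next
    case False
    have "P0 \<le> ?M" unfolding P0_def using T(3) sum_x0 by (intro few) (auto simp: x0_def)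
    then show ?thesis using False by linarith
  qed
  define K where "K = {i \<in> {1..T}. 0 < xm i}"
  have K: "finite K" "K \<subseteq> {1..T}" by (auto simp: K_def)
  have zero: "xm i = 0" if "i \<in> {1..T} - K" for i
    using that xm(1) by (force simp: K_def)
  have sumK: "(\<Sum>i\<in>K. xm i) = 1"
    using sum.mono_neutral_right[of "{1..T}" K xm] K zero xm(2) by auto
  then have "K \<noteq> {}" by auto
  obtain g where g: "bij_betw g {1..card K} K" using ex_bij_betw_nat_finite_1[OF K(1)] by blast
  have "?M = labelled_density a R K xm"
    using fin K a_pos zero by (intro labelled_density_support) auto
  also have "\<dots> = labelled_density a R {1..card K} (xm \<circ> g)"
    by (rule labelled_density_reindex[OF g, symmetric])
  finally have M: "?M = labelled_density a R {1..card K} (xm \<circ> g)" .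
  have "partite_weights (card K) (xm \<circ> g)"
    unfolding partite_weights_def
  proof
    show "\<forall>i\<in>{1..card K}. 0 < (xm \<circ> g) i" using g by (auto simp: bij_betw_def K_def)
    show "(\<Sum>i=1..card K. (xm \<circ> g) i) = 1"
      using sum.reindex_bij_betw[OF g, of xm] sumK by simp
  qed
  moreover have "1 \<le> card K" using \<open>K \<noteq> {}\<close> K by (simp add: Suc_le_eq card_gt_0_iff)
  ultimately show ?thesis using all M by metis
qed

section \<open>Embeddings and induced copies\<close>

text \<open>
  Restricting to extensional functions makes the set finite and makes the embeddings with a given
  image correspond to automorphisms.
\<close>

definition embeddings :: "'f pair_pre_digraph \<Rightarrow> 'a pair_pre_digraph \<Rightarrow> ('f \<Rightarrow> 'a) set" where
  "embeddings F G = {\<phi> \<in> pverts F \<rightarrow>\<^sub>E pverts G. inj_on \<phi> (pverts F) \<and>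
     (\<forall>p\<in>pverts F. \<forall>q\<in>pverts F. (p, q) \<in> parcs F \<longleftrightarrow> (\<phi> p, \<phi> q) \<in> parcs G)}"

definition partite_graph :: "'a set \<Rightarrow> ('a \<Rightarrow> 'c) \<Rightarrow> 'a pair_pre_digraph" where
  "partite_graph V c = \<lparr> pverts = V, parcs = {(u, v). u \<in> V \<and> v \<in> V \<and> c u \<noteq> c v} \<rparr>"

lemma partite_graph_simps [simp]:
  "pverts (partite_graph V c) = V"
  "(u, v) \<in> parcs (partite_graph V c) \<longleftrightarrow> u \<in> V \<and> v \<in> V \<and> c u \<noteq> c v"
  by (auto simp: partite_graph_def)

lemma pair_graph_partite_graph:
  assumes "finite V"
  shows "pair_graph (partite_graph V c)"
proof -
  have "finite (parcs (partite_graph V c))"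
    by (rule finite_subset[of _ "V \<times> V"]) (use assms in \<open>auto simp: partite_graph_def\<close>)
  then show ?thesis
    using assms by unfold_locales (auto simp: partite_graph_def symmetric_def intro!: symI)
qed

lemma finite_embeddings:
  "finite (pverts F) \<Longrightarrow> finite (pverts G) \<Longrightarrow> finite (embeddings F G)"
  unfolding embeddings_def
  by (rule finite_subset[of _ "pverts F \<rightarrow>\<^sub>E pverts G"]) (auto intro: finite_PiE)

text \<open>
  Arcs are pairs of vertices, so the arc map of an isomorphism is determined by its vertex map, whose
  inverse is the embedding.
\<close>

lemma digraph_iso_induced_iff:
  assumes "pair_wf_digraph F" "pair_wf_digraph G" "S \<subseteq> pverts G"
  shows "digraph_iso (with_proj G \<restriction> S) (with_proj F)
    \<longleftrightarrow> (\<exists>\<phi>\<in>embeddings F G. \<phi> ` pverts F = S)"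
proof
  let ?H = "with_proj G \<restriction> S"
  interpret F: pair_wf_digraph F by fact
  interpret G: pair_wf_digraph G by fact
  {
    assume "digraph_iso ?H (with_proj F)"
    then obtain f where f: "pre_digraph.digraph_isomorphism ?H f" "with_proj F = app_iso f ?H"
      by (auto simp: digraph_iso_def)
    let ?\<psi> = "iso_verts f"
    have inj: "inj_on ?\<psi> S" using f(1) by (simp add: pre_digraph.digraph_isomorphism_def)
    have VF: "pverts F = ?\<psi> ` S" using arg_cong[OF f(2), of verts] by simp
    have tl: "iso_tail f = fst" "iso_head f = snd"
      using arg_cong[OF f(2), of tail] arg_cong[OF f(2), of head] by simp_all
    have arc: "iso_arcs f (u, v) = (?\<psi> u, ?\<psi> v)" if "(u, v) \<in> parcs G" "u \<in> S" "v \<in> S" for u v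
      using f(1) that tl by (fastforce simp: pre_digraph.digraph_isomorphism_def intro: prod_eqI)
    have "parcs F = iso_arcs f ` {e \<in> parcs G. fst e \<in> S \<and> snd e \<in> S}"
      using arg_cong[OF f(2), of arcs] by simp
    also have "\<dots> = (\<lambda>(u, v). (?\<psi> u, ?\<psi> v)) ` {e \<in> parcs G. fst e \<in> S \<and> snd e \<in> S}"
      using arc by (intro image_cong) auto
    finally have AF: "parcs F = \<dots>" .
    have adj: "(?\<psi> u, ?\<psi> v) \<in> parcs F \<longleftrightarrow> (u, v) \<in> parcs G" if "u \<in> S" "v \<in> S" for u v
    proof
      assume "(?\<psi> u, ?\<psi> v) \<in> parcs F"
      then obtain u' v' where e: "(u', v') \<in> parcs G" "u' \<in> S" "v' \<in> S"
        "?\<psi> u = ?\<psi> u'" "?\<psi> v = ?\<psi> v'"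
        unfolding AF by auto
      then have "u = u'" "v = v'" using inj that by (auto dest: inj_onD)
      then show "(u, v) \<in> parcs G" using e(1) by simp
    next
      assume "(u, v) \<in> parcs G"
      then show "(?\<psi> u, ?\<psi> v) \<in> parcs F"
        unfolding AF using that by (intro image_eqI[of _ _ "(u, v)"]) auto
    qed
    define \<phi> where "\<phi> = restrict (the_inv_into S ?\<psi>) (pverts F)"
    have \<phi>: "\<phi> (?\<psi> u) = u" if "u \<in> S" for u
      using that the_inv_into_f_f[OF inj] by (simp add: \<phi>_def VF)
    have "\<phi> \<in> embeddings F G"
      unfolding embeddings_def
    proof (intro CollectI conjI ballI)
      show "\<phi> \<in> pverts F \<rightarrow>\<^sub>E pverts G"
        using \<phi> assms(3) unfolding VF by (auto simp: PiE_iff extensional_def \<phi>_def VF)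
      show "inj_on \<phi> (pverts F)" unfolding VF using \<phi> by (auto simp: inj_on_def)
      show "(p, q) \<in> parcs F \<longleftrightarrow> (\<phi> p, \<phi> q) \<in> parcs G" if "p \<in> pverts F" "q \<in> pverts F" for p q
        using that \<phi> adj unfolding VF by auto
    qed
    moreover have "\<phi> ` pverts F = S" unfolding VF using \<phi> by force
    ultimately show "\<exists>\<phi>\<in>embeddings F G. \<phi> ` pverts F = S" by blast
  next
    assume "\<exists>\<phi>\<in>embeddings F G. \<phi> ` pverts F = S"
    then obtain \<phi> where \<phi>: "\<phi> \<in> embeddings F G" "\<phi> ` pverts F = S" by blast
    have inj: "inj_on \<phi> (pverts F)" using \<phi> by (simp add: embeddings_def)
    define \<psi> where "\<psi> = the_inv_into (pverts F) \<phi>"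
    have \<psi>: "\<psi> (\<phi> p) = p" if "p \<in> pverts F" for p
      using that the_inv_into_f_f[OF inj] by (simp add: \<psi>_def)
    have adj: "(p, q) \<in> parcs F \<longleftrightarrow> (\<phi> p, \<phi> q) \<in> parcs G" if "p \<in> pverts F" "q \<in> pverts F" for p q
      using \<phi>(1) that by (simp add: embeddings_def)
    define f where "f = \<lparr> iso_verts = \<psi>, iso_arcs = map_prod \<psi> \<psi>, iso_head = snd, iso_tail = fst \<rparr>"
    have injS: "inj_on \<psi> S" using \<phi>(2) \<psi> by (auto simp: inj_on_def)
    have "wf_digraph ?H" by (rule G.wellformed_induce_subgraph)
    moreover have "inj_on (map_prod \<psi> \<psi>) {e \<in> parcs G. fst e \<in> S \<and> snd e \<in> S}"
      using injS by (auto simp: inj_on_def)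
    ultimately have "pre_digraph.digraph_isomorphism ?H f"
      using injS by (auto simp: pre_digraph.digraph_isomorphism_def f_def)
    moreover have "with_proj F = app_iso f ?H"
    proof -
      have "pverts F = \<psi> ` S" using \<phi>(2) \<psi> by force
      moreover have "parcs F = map_prod \<psi> \<psi> ` {e \<in> parcs G. fst e \<in> S \<and> snd e \<in> S}"
      proof (intro set_eqI iffI)
        fix e assume e: "e \<in> parcs F"
        obtain p q where pq: "e = (p, q)" by fastforce
        then have V: "p \<in> pverts F" "q \<in> pverts F"
          using e F.in_arcsD1 F.in_arcsD2 by blast+
        then have "(\<phi> p, \<phi> q) \<in> {e \<in> parcs G. fst e \<in> S \<and> snd e \<in> S}"
          using e pq adj \<phi>(2) by auto
        moreover have "e = map_prod \<psi> \<psi> (\<phi> p, \<phi> q)" using pq V \<psi> by simp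
        ultimately show "e \<in> map_prod \<psi> \<psi> ` {e \<in> parcs G. fst e \<in> S \<and> snd e \<in> S}" by blast
      next
        fix e assume "e \<in> map_prod \<psi> \<psi> ` {e \<in> parcs G. fst e \<in> S \<and> snd e \<in> S}"
        then obtain u v where uv: "(u, v) \<in> parcs G" "u \<in> S" "v \<in> S" "e = (\<psi> u, \<psi> v)" by auto
        then obtain p q where "p \<in> pverts F" "q \<in> pverts F" "u = \<phi> p" "v = \<phi> q"
          using \<phi>(2) by blast
        then show "e \<in> parcs F" using uv adj \<psi> by simp
      qed
      ultimately show ?thesis
        by (intro pre_digraph.equality) (auto simp: f_def)
    qed
    ultimately show "digraph_iso ?H (with_proj F)" by (auto simp: digraph_iso_def)
  }
qed

lemma automorphism_image:
  assumes "finite (pverts F)" "\<alpha> \<in> embeddings F F"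
  shows "\<alpha> ` pverts F = pverts F"
  using assms by (intro endo_inj_surj) (auto simp: embeddings_def)

text \<open>
  Embeddings are grouped by their image. Composing a fixed embedding with automorphisms yields all
  embeddings with the same image, so all groups have the same size.
\<close>

lemma card_embeddings:
  assumes "pair_graph F" "pair_graph G"
  shows "card (embeddings F G) = card (embeddings F F) * ind_count F G"
proof -
  interpret F: pair_graph F by fact
  interpret G: pair_graph G by fact
  note finF = F.pair_finite_verts and finG = G.pair_finite_verts
  define \<S> where "\<S> = {S. S \<subseteq> pverts G \<and> card S = card (pverts F)
              \<and> digraph_iso (with_proj G \<restriction> S) (with_proj F)}"
  define on where "on S = {\<phi> \<in> embeddings F G. \<phi> ` pverts F = S}" for S
  have \<S>: "S \<in> \<S> \<longleftrightarrow> S \<subseteq> pverts G \<and> (\<exists>\<phi>\<in>embeddings F G. \<phi> ` pverts F = S)" for S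
    using digraph_iso_induced_iff[OF F.pair_wf_digraph G.pair_wf_digraph, of S]
    unfolding \<S>_def by (auto simp: card_image embeddings_def)
  have fin\<S>: "finite \<S>" unfolding \<S>_def using finG by simp
  have fiber: "card (on S) = card (embeddings F F)" if S: "S \<in> \<S>" for S
  proof -
    obtain \<phi> where \<phi>: "\<phi> \<in> embeddings F G" "\<phi> ` pverts F = S"
      using S unfolding \<S>[of S] by blast
    have inj: "inj_on \<phi> (pverts F)" using \<phi> by (simp add: embeddings_def)
    have "bij_betw (\<lambda>\<alpha>. restrict (\<phi> \<circ> \<alpha>) (pverts F)) (embeddings F F) (on S)"
    proof (rule bij_betwI[where g = "\<lambda>\<phi>'. restrict (the_inv_into (pverts F) \<phi> \<circ> \<phi>') (pverts F)"])
      show "(\<lambda>\<alpha>. restrict (\<phi> \<circ> \<alpha>) (pverts F)) \<in> embeddings F F \<rightarrow> on S"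
      proof
        fix \<alpha> assume \<alpha>: "\<alpha> \<in> embeddings F F"
        have im: "\<alpha> ` pverts F = pverts F" by (rule automorphism_image[OF finF \<alpha>])
        then have mem: "\<alpha> p \<in> pverts F" if "p \<in> pverts F" for p using that by blast
        have "restrict (\<phi> \<circ> \<alpha>) (pverts F) ` pverts F = \<phi> ` \<alpha> ` pverts F"
          by (simp add: image_image)
        then have "restrict (\<phi> \<circ> \<alpha>) (pverts F) ` pverts F = S" using im \<phi>(2) by simp
        moreover have "inj_on (\<phi> \<circ> \<alpha>) (pverts F)"
          using \<alpha> im inj by (intro comp_inj_on) (auto simp: embeddings_def)
        ultimately show "restrict (\<phi> \<circ> \<alpha>) (pverts F) \<in> on S"
          using \<phi> \<alpha> mem unfolding on_def embeddings_def by (auto simp: inj_on_def)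
      qed
      show "(\<lambda>\<phi>'. restrict (the_inv_into (pverts F) \<phi> \<circ> \<phi>') (pverts F)) \<in> on S \<rightarrow> embeddings F F"
      proof
        fix \<phi>' assume \<phi>': "\<phi>' \<in> on S"
        let ?\<alpha> = "restrict (the_inv_into (pverts F) \<phi> \<circ> \<phi>') (pverts F)"
        have mem: "\<phi>' p \<in> \<phi> ` pverts F" if "p \<in> pverts F" for p
          using \<phi>' that \<phi>(2) by (auto simp: on_def)
        have \<alpha>: "?\<alpha> p \<in> pverts F" "\<phi> (?\<alpha> p) = \<phi>' p" if "p \<in> pverts F" for p
          using that mem[OF that] the_inv_into_into[OF inj _ subset_refl] f_the_inv_into_f[OF inj]
          by auto
        have \<phi>'e: "\<phi>' \<in> embeddings F G" using \<phi>' by (simp add: on_def)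
        show "?\<alpha> \<in> embeddings F F"
          unfolding embeddings_def
        proof (intro CollectI conjI ballI)
          show "?\<alpha> \<in> pverts F \<rightarrow>\<^sub>E pverts F" using \<alpha>(1) by auto
          show "inj_on ?\<alpha> (pverts F)"
          proof (rule inj_onI)
            fix p q assume pq: "p \<in> pverts F" "q \<in> pverts F" "?\<alpha> p = ?\<alpha> q"
            then have "\<phi>' p = \<phi>' q" using \<alpha>(2) by metis
            then show "p = q" using pq \<phi>'e by (auto simp: embeddings_def inj_on_def)
          qed
          fix p q assume pq: "p \<in> pverts F" "q \<in> pverts F"
          have "(p, q) \<in> parcs F \<longleftrightarrow> (\<phi> (?\<alpha> p), \<phi> (?\<alpha> q)) \<in> parcs G"
            unfolding \<alpha>(2)[OF pq(1)] \<alpha>(2)[OF pq(2)] using \<phi>'e pq by (simp add: embeddings_def)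
          also have "\<dots> \<longleftrightarrow> (?\<alpha> p, ?\<alpha> q) \<in> parcs F"
            using \<phi>(1) \<alpha>(1)[OF pq(1)] \<alpha>(1)[OF pq(2)] unfolding embeddings_def by blast
          finally show "(p, q) \<in> parcs F \<longleftrightarrow> (?\<alpha> p, ?\<alpha> q) \<in> parcs F" .
        qed
      qed
      show "restrict (the_inv_into (pverts F) \<phi> \<circ> restrict (\<phi> \<circ> \<alpha>) (pverts F)) (pverts F) = \<alpha>"
        if "\<alpha> \<in> embeddings F F" for \<alpha>
        using that the_inv_into_f_f[OF inj]
        by (auto simp: embeddings_def PiE_iff extensional_def fun_eq_iff)
      show "restrict (\<phi> \<circ> restrict (the_inv_into (pverts F) \<phi> \<circ> \<phi>') (pverts F)) (pverts F) = \<phi>'"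
        if "\<phi>' \<in> on S" for \<phi>'
      proof
        fix p
        have "\<phi>' p \<in> \<phi> ` pverts F" if "p \<in> pverts F"
          using \<open>\<phi>' \<in> on S\<close> that \<phi>(2) by (auto simp: on_def)
        moreover have "\<phi>' p = undefined" if "p \<notin> pverts F"
          using \<open>\<phi>' \<in> on S\<close> that by (auto simp: on_def embeddings_def PiE_iff extensional_def)
        ultimately show "restrict (\<phi> \<circ> restrict (the_inv_into (pverts F) \<phi> \<circ> \<phi>') (pverts F)) (pverts F) p = \<phi>' p"
          using f_the_inv_into_f[OF inj] by simp
      qed
    qed
    then show ?thesis by (simp add: bij_betw_same_card)
  qed
  have "\<phi> ` pverts F \<in> \<S>" if "\<phi> \<in> embeddings F G" for \<phi>
    unfolding \<S> using that by (auto simp: embeddings_def PiE_iff)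
  then have "embeddings F G = (\<Union>S\<in>\<S>. on S)"
    by (auto simp: on_def)
  also have "card \<dots> = (\<Sum>S\<in>\<S>. card (on S))"
  proof (rule card_UN_disjoint[OF fin\<S>])
    show "\<forall>S\<in>\<S>. finite (on S)" using finite_embeddings[OF finF finG] by (simp add: on_def)
    show "\<forall>S\<in>\<S>. \<forall>S'\<in>\<S>. S \<noteq> S' \<longrightarrow> on S \<inter> on S' = {}" by (auto simp: on_def)
  qed
  also have "\<dots> = card (embeddings F F) * ind_count F G"
    using fiber by (simp add: ind_count_def \<S>_def)
  finally show ?thesis .
qed


section \<open>Zykov symmetrization\<close>

text \<open>
  The vertex \<open>u\<close> is replaced by a copy of \<open>v\<close>: adjacency is pulled back along the map that sends
  \<open>u\<close> to \<open>v\<close> and fixes the other vertices.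
\<close>

definition clone :: "'a pair_pre_digraph \<Rightarrow> 'a \<Rightarrow> 'a \<Rightarrow> 'a pair_pre_digraph" where
  "clone G u v = \<lparr> pverts = pverts G,
     parcs = {(x, y). x \<in> pverts G \<and> y \<in> pverts G \<and> ((id(u := v)) x, (id(u := v)) y) \<in> parcs G} \<rparr>"

definition twin_pairs :: "'a pair_pre_digraph \<Rightarrow> ('a \<times> 'a) set" where
  "twin_pairs G = {(x, y). x \<in> pverts G \<and> y \<in> pverts G \<and> parcs G `` {x} = parcs G `` {y}}"

definition twins_of :: "'a pair_pre_digraph \<Rightarrow> 'a \<Rightarrow> 'a set" where
  "twins_of G u = {x \<in> pverts G. parcs G `` {x} = parcs G `` {u}}"

lemma clone_simps [simp]:
  "pverts (clone G u v) = pverts G"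
  "(x, y) \<in> parcs (clone G u v) \<longleftrightarrow>
     x \<in> pverts G \<and> y \<in> pverts G \<and> ((id(u := v)) x, (id(u := v)) y) \<in> parcs G"
  by (simp_all add: clone_def)

lemma pair_graph_clone:
  assumes "pair_graph G"
  shows "pair_graph (clone G u v)"
proof -
  interpret pair_graph G by fact
  show ?thesis
  proof unfold_locales
    show "finite (parcs (clone G u v))"
      by (rule finite_subset[of _ "pverts G \<times> pverts G"]) (auto simp: clone_def pair_finite_verts)
    have "(x, y) \<in> parcs (clone G u v) \<Longrightarrow> (y, x) \<in> parcs (clone G u v)" for x y
      using arcs_symmetric by (simp del: fun_upd_apply)
    then show "symmetric (with_proj (clone G u v))"
      by (auto simp: symmetric_def intro!: symI simp del: clone_simps)
    show "fst e \<noteq> snd e" if "e \<in> parcs (clone G u v)" for e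
      using that no_loops' by (cases e) (auto simp del: fun_upd_apply)
  qed (auto simp: clone_def pair_finite_verts)
qed

text \<open>
  The vertex \<open>u\<close> leaves its class of twins and joins the class of \<open>v\<close>, while all other twins stay
  twins. Moving a vertex into a class that is at least as large increases the number of pairs.
\<close>

lemma card_twin_pairs_clone:
  assumes "pair_graph G" and uv: "u \<in> pverts G" "v \<in> pverts G" "parcs G `` {u} \<noteq> parcs G `` {v}"
    and le: "card (twins_of G u) \<le> card (twins_of G v)"
  shows "card (twin_pairs G) < card (twin_pairs (clone G u v))"
proof -
  interpret pair_graph G by fact
  let ?V = "pverts G"
  let ?T0 = "{(x, y) \<in> twin_pairs G. x \<noteq> u \<and> y \<noteq> u}"
  let ?A = "twins_of G u" and ?B = "twins_of G v"
  have fin: "finite ?T0" "finite ?A" "finite ?B" "finite (twin_pairs (clone G u v))"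
    using pair_finite_verts
    by (auto simp: twin_pairs_def twins_of_def intro: finite_subset[of _ "?V \<times> ?V"])
  have uA: "u \<in> ?A" and uB: "u \<notin> ?B" using uv by (auto simp: twins_of_def)
  have "twin_pairs G \<subseteq> ?T0 \<union> ({u} \<times> ?A \<union> (?A - {u}) \<times> {u})"
    by (auto simp: twin_pairs_def twins_of_def)
  then have "card (twin_pairs G) \<le> card (?T0 \<union> ({u} \<times> ?A \<union> (?A - {u}) \<times> {u}))"
    using fin by (intro card_mono) auto
  also have "\<dots> \<le> card ?T0 + (card ({u} \<times> ?A) + card ((?A - {u}) \<times> {u}))"
    by (intro order_trans[OF card_Un_le] add_mono card_Un_le order_refl)
  also have "\<dots> < card ?T0 + (card ?B + card ?B)"
  proof -
    have "card (?A - {u}) < card ?A" using uA fin by (intro card_Diff1_less) auto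
    then show ?thesis using le by (simp add: card_cartesian_product)
  qed
  also have "\<dots> = card (?T0 \<union> ({u} \<times> ?B \<union> ?B \<times> {u}))"
    using fin uB by (subst card_Un_disjoint, auto)+
  also have "\<dots> \<le> card (twin_pairs (clone G u v))"
  proof (rule card_mono[OF fin(4)])
    have nb: "parcs (clone G u v) `` {x} = {y \<in> ?V. (id(u := v)) y \<in> parcs G `` {x}}"
      if "x \<in> ?V" "x \<noteq> u" for x
      using that by auto
    have nbu: "parcs (clone G u v) `` {u} = {y \<in> ?V. (id(u := v)) y \<in> parcs G `` {v}}"
      using uv by auto
    have "?T0 \<subseteq> twin_pairs (clone G u v)"
    proof
      fix z assume "z \<in> ?T0"
      then obtain x y where z: "z = (x, y)" "x \<in> ?V" "y \<in> ?V" "x \<noteq> u" "y \<noteq> u"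
        "parcs G `` {x} = parcs G `` {y}"
        by (auto simp: twin_pairs_def)
      have "parcs (clone G u v) `` {x} = parcs (clone G u v) `` {y}"
        unfolding nb[OF z(2,4)] nb[OF z(3,5)] z(6) ..
      then show "z \<in> twin_pairs (clone G u v)" using z by (simp add: twin_pairs_def del: clone_simps(2))
    qed
    moreover have "parcs (clone G u v) `` {x} = parcs (clone G u v) `` {u}" if "x \<in> ?B" for x
    proof -
      have x: "x \<in> ?V" "x \<noteq> u" "parcs G `` {x} = parcs G `` {v}"
        using that uB by (auto simp: twins_of_def)
      show ?thesis unfolding nb[OF x(1,2)] nbu x(3) ..
    qed
    ultimately show "?T0 \<union> ({u} \<times> ?B \<union> ?B \<times> {u}) \<subseteq> twin_pairs (clone G u v)"
      using uv by (auto simp: twin_pairs_def twins_of_def)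
  qed
  finally show ?thesis .
qed

text \<open>
  Embeddings avoiding \<open>u\<close> are unaffected, and those using \<open>v\<close> alone can be redirected to
  the clone. An embedding using both \<open>u\<close> and \<open>v\<close> survives because these are non-adjacent:
  their preimages then lie in one part, so they have the same neighbours, and the images of the
  other vertices are as adjacent to \<open>u\<close> as to \<open>v\<close>.
\<close>

lemma card_embeddings_clone:
  fixes G :: "'a pair_pre_digraph" and V :: "'f set" and c :: "'f \<Rightarrow> 'c"
  assumes "pair_graph G" "finite V" and uv: "u \<in> pverts G" "v \<in> pverts G" "u \<noteq> v" "(u, v) \<notin> parcs G"
  defines "\<E> \<equiv> \<lambda>P. {\<phi> \<in> embeddings (partite_graph V c) G. P (\<phi> ` V)}"
  shows "card (embeddings (partite_graph V c) G) + card (\<E> (\<lambda>S. v \<in> S \<and> u \<notin> S))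
    \<le> card (embeddings (partite_graph V c) (clone G u v)) + card (\<E> (\<lambda>S. u \<in> S \<and> v \<notin> S))"
proof -
  interpret pair_graph G by fact
  let ?F = "partite_graph V c"
  let ?G' = "clone G u v"
  let ?\<pi> = "id(u := v)"
  define \<E>' where "\<E>' P = {\<phi> \<in> embeddings ?F ?G'. P (\<phi> ` V)}" for P
  have fin: "finite (embeddings ?F G)" "finite (embeddings ?F ?G')"
    using assms(2) pair_finite_verts by (auto intro: finite_embeddings)
  have finE: "finite (\<E> P)" "finite (\<E>' P)" for P
    using fin by (auto simp: \<E>_def \<E>'_def)
  have split: "card (embeddings ?F H) = card {\<phi> \<in> embeddings ?F H. u \<notin> \<phi> ` V}
      + (card {\<phi> \<in> embeddings ?F H. u \<in> \<phi> ` V \<and> v \<notin> \<phi> ` V}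
        + card {\<phi> \<in> embeddings ?F H. u \<in> \<phi> ` V \<and> v \<in> \<phi> ` V})"
    if "finite (embeddings ?F H)" for H :: "'a pair_pre_digraph"
    using that by (subst card_Un_disjoint[symmetric], simp, simp, blast)+ (auto intro: arg_cong[where f = card])
  have splitG: "card (embeddings ?F G)
      = card (\<E> (\<lambda>S. u \<notin> S)) + (card (\<E> (\<lambda>S. u \<in> S \<and> v \<notin> S)) + card (\<E> (\<lambda>S. u \<in> S \<and> v \<in> S)))"
    unfolding \<E>_def by (rule split[OF fin(1)])
  have splitG': "card (embeddings ?F ?G')
      = card (\<E>' (\<lambda>S. u \<notin> S)) + (card (\<E>' (\<lambda>S. u \<in> S \<and> v \<notin> S)) + card (\<E>' (\<lambda>S. u \<in> S \<and> v \<in> S)))"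
    unfolding \<E>'_def by (rule split[OF fin(2)])
  have embG: "\<phi> \<in> embeddings ?F G \<longleftrightarrow> \<phi> \<in> V \<rightarrow>\<^sub>E pverts G \<and> inj_on \<phi> V
      \<and> (\<forall>p\<in>V. \<forall>q\<in>V. c p \<noteq> c q \<longleftrightarrow> (\<phi> p, \<phi> q) \<in> parcs G)" for \<phi>
    by (auto simp: embeddings_def)
  have embG': "\<phi> \<in> embeddings ?F ?G' \<longleftrightarrow> \<phi> \<in> V \<rightarrow>\<^sub>E pverts G \<and> inj_on \<phi> V
      \<and> (\<forall>p\<in>V. \<forall>q\<in>V. c p \<noteq> c q \<longleftrightarrow> (?\<pi> (\<phi> p), ?\<pi> (\<phi> q)) \<in> parcs G)" for \<phi>
    by (auto simp: embeddings_def PiE_iff simp del: fun_upd_apply)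
  have "\<E> (\<lambda>S. u \<notin> S) \<subseteq> \<E>' (\<lambda>S. u \<notin> S)"
  proof
    fix \<phi> assume "\<phi> \<in> \<E> (\<lambda>S. u \<notin> S)"
    then have \<phi>: "\<phi> \<in> embeddings ?F G" "u \<notin> \<phi> ` V" by (auto simp: \<E>_def)
    then have "?\<pi> (\<phi> p) = \<phi> p" if "p \<in> V" for p using that by auto
    then show "\<phi> \<in> \<E>' (\<lambda>S. u \<notin> S)"
      using \<phi> by (simp add: \<E>'_def embG embG' del: fun_upd_apply)
  qed
  then have none: "card (\<E> (\<lambda>S. u \<notin> S)) \<le> card (\<E>' (\<lambda>S. u \<notin> S))"
    using finE by (intro card_mono) auto
  have one: "card (\<E> (\<lambda>S. v \<in> S \<and> u \<notin> S)) \<le> card (\<E>' (\<lambda>S. u \<in> S \<and> v \<notin> S))"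
  proof (rule card_inj_on_le[where f = "\<lambda>\<phi>. restrict ((id(v := u)) \<circ> \<phi>) V"])
    show "finite (\<E>' (\<lambda>S. u \<in> S \<and> v \<notin> S))" by (rule finE)
    show "inj_on (\<lambda>\<phi>. restrict ((id(v := u)) \<circ> \<phi>) V) (\<E> (\<lambda>S. v \<in> S \<and> u \<notin> S))"
    proof (rule inj_onI, rule ext)
      fix \<phi> \<psi> p
      assume m: "\<phi> \<in> \<E> (\<lambda>S. v \<in> S \<and> u \<notin> S)" "\<psi> \<in> \<E> (\<lambda>S. v \<in> S \<and> u \<notin> S)"
        and eq: "restrict ((id(v := u)) \<circ> \<phi>) V = restrict ((id(v := u)) \<circ> \<psi>) V"
      show "\<phi> p = \<psi> p"
      proof (cases "p \<in> V")
        case True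
        then have "\<phi> p \<noteq> u" "\<psi> p \<noteq> u" using m by (auto simp: \<E>_def)
        moreover have "(id(v := u)) (\<phi> p) = (id(v := u)) (\<psi> p)"
          using fun_cong[OF eq, of p] True by simp
        ultimately show ?thesis by (auto split: if_splits)
      next
        case False
        then show ?thesis using m by (auto simp: \<E>_def embG PiE_iff extensional_def)
      qed
    qed
    show "(\<lambda>\<phi>. restrict ((id(v := u)) \<circ> \<phi>) V) ` \<E> (\<lambda>S. v \<in> S \<and> u \<notin> S)
        \<subseteq> \<E>' (\<lambda>S. u \<in> S \<and> v \<notin> S)"
    proof
      fix \<psi> assume "\<psi> \<in> (\<lambda>\<phi>. restrict ((id(v := u)) \<circ> \<phi>) V) ` \<E> (\<lambda>S. v \<in> S \<and> u \<notin> S)"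
      then obtain \<phi> where \<psi>: "\<psi> = restrict ((id(v := u)) \<circ> \<phi>) V"
        and \<phi>: "\<phi> \<in> embeddings ?F G" "v \<in> \<phi> ` V" "u \<notin> \<phi> ` V" by (auto simp: \<E>_def)
      have cancel_swap: "?\<pi> (\<psi> p) = \<phi> p" if "p \<in> V" for p using that \<phi>(3) by (auto simp: \<psi>)
      have "\<psi> ` V \<subseteq> pverts G" using \<phi>(1) uv by (auto simp: \<psi> embG PiE_iff)
      moreover have "inj_on \<psi> V"
        using cancel_swap \<phi>(1) unfolding embG inj_on_def by metis
      moreover have "u \<in> \<psi> ` V" "v \<notin> \<psi> ` V" using \<phi>(2,3) uv by (auto simp: \<psi> image_iff)
      ultimately show "\<psi> \<in> \<E>' (\<lambda>S. u \<in> S \<and> v \<notin> S)"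
        using \<phi>(1) cancel_swap by (auto simp: \<E>'_def embG embG' \<psi> PiE_iff simp del: fun_upd_apply)
    qed
  qed
  have "\<E> (\<lambda>S. u \<in> S \<and> v \<in> S) \<subseteq> \<E>' (\<lambda>S. u \<in> S \<and> v \<in> S)"
  proof
    fix \<phi> assume "\<phi> \<in> \<E> (\<lambda>S. u \<in> S \<and> v \<in> S)"
    then have \<phi>: "\<phi> \<in> embeddings ?F G" "u \<in> \<phi> ` V" "v \<in> \<phi> ` V" by (auto simp: \<E>_def)
    then obtain p' q where pq: "p' \<in> V" "q \<in> V" "\<phi> p' = u" "\<phi> q = v" by auto
    define \<tau> where "\<tau> = id(p' := q)"
    have "c p' = c q" using \<phi>(1) pq uv(4) by (auto simp: embG)
    then have c\<tau>: "c (\<tau> p) = c p" for p by (simp add: \<tau>_def)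
    have \<tau>V: "\<tau> p \<in> V" if "p \<in> V" for p using that pq by (simp add: \<tau>_def)
    have "?\<pi> (\<phi> p) = \<phi> (\<tau> p)" if "p \<in> V" for p
      using that pq \<phi>(1) by (auto simp: \<tau>_def embG inj_on_def)
    then show "\<phi> \<in> \<E>' (\<lambda>S. u \<in> S \<and> v \<in> S)"
      using \<phi> c\<tau> \<tau>V by (simp add: \<E>'_def embG embG' del: fun_upd_apply) metis
  qed
  then have both: "card (\<E> (\<lambda>S. u \<in> S \<and> v \<in> S)) \<le> card (\<E>' (\<lambda>S. u \<in> S \<and> v \<in> S))"
    using finE by (intro card_mono) auto
  show ?thesis unfolding splitG splitG' using none one both by linarith
qed

text \<open>
  Zykov symmetrization. Among the graphs on the same vertices with the most embeddings, one with the
  most pairs of twins is chosen. If it had two non-adjacent vertices that are not twins,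
  maximality would force both clonings to preserve the number of embeddings, and the one that moves
  a vertex into the larger class would create more twins. So non-adjacency coincides with being
  twins, which is an equivalence relation.
\<close>

lemma ex_partite_graph_max_embeddings:
  fixes G :: "nat pair_pre_digraph"
  assumes "pair_graph G" "finite V"
  shows "\<exists>d :: nat \<Rightarrow> nat. d ` pverts G \<subseteq> pverts G \<and>
    card (embeddings (partite_graph V c) G)
      \<le> card (embeddings (partite_graph V c) (partite_graph (pverts G) d))"
proof -
  let ?F = "partite_graph V c"
  define W where "W = pverts G"
  interpret G: pair_graph G by fact
  have finW: "finite W" unfolding W_def by (rule G.pair_finite_verts)
  define N where "N = card (W \<times> W)"
  \<comment> \<open>The factor exceeds every possible number of twin pairs, so \<open>\<Psi>\<close> orders graphs lexicographically.\<close>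
  define \<Psi> where "\<Psi> H = card (embeddings ?F H) * (N + 1) + card (twin_pairs H)"
    for H :: "nat pair_pre_digraph"
  define ok where "ok H \<longleftrightarrow> pair_graph H \<and> pverts H = W" for H
  have twins_le: "card (twin_pairs H) \<le> N" if "ok H" for H
    unfolding N_def using that finW by (intro card_mono) (auto simp: ok_def twin_pairs_def)
  have emb_le: "card (embeddings ?F H) \<le> card (V \<rightarrow>\<^sub>E W)" if "ok H" for H
    using that finW assms(2) by (intro card_mono finite_PiE) (auto simp: ok_def embeddings_def)
  have bound: "\<Psi> H < card (V \<rightarrow>\<^sub>E W) * (N + 1) + N + 1" if "ok H" for H
    using mult_le_mono1[OF emb_le[OF that], of "N + 1"] twins_le[OF that] by (simp add: \<Psi>_def)
  have okG: "ok G" using assms(1) by (simp add: ok_def W_def)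
  have "\<exists>H. ok H \<and> (\<forall>H'. ok H' \<longrightarrow> \<Psi> H' \<le> \<Psi> H)"
    using bound by (intro ex_has_greatest_nat[of ok G \<Psi>, OF okG]) auto
  then obtain H where H: "ok H" "\<And>H'. ok H' \<Longrightarrow> \<Psi> H' \<le> \<Psi> H" by auto
  have lex: "card (embeddings ?F H') < card (embeddings ?F H) \<or>
      card (embeddings ?F H') = card (embeddings ?F H) \<and> card (twin_pairs H') \<le> card (twin_pairs H)"
    if "ok H'" for H'
  proof (rule ccontr)
    assume "\<not> ?thesis"
    then consider "card (embeddings ?F H) + 1 \<le> card (embeddings ?F H')"
      | "card (embeddings ?F H') = card (embeddings ?F H)" "card (twin_pairs H) < card (twin_pairs H')"
      by linarith
    then have "\<Psi> H < \<Psi> H'"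
    proof cases
      case 1
      have "\<Psi> H \<le> card (embeddings ?F H) * (N + 1) + N"
        unfolding \<Psi>_def using twins_le[OF H(1)] by simp
      also have "\<dots> < (card (embeddings ?F H) + 1) * (N + 1)" by simp
      also have "\<dots> \<le> card (embeddings ?F H') * (N + 1)" by (rule mult_le_mono1[OF 1])
      also have "\<dots> \<le> \<Psi> H'" by (simp add: \<Psi>_def)
      finally show ?thesis .
    qed (simp add: \<Psi>_def)
    with H(2)[OF that] show False by simp
  qed
  interpret H: pair_graph H using H(1) by (simp add: ok_def)
  have VH: "pverts H = W" using H(1) by (simp add: ok_def)
  \<comment> \<open>Cloning in one of the two directions would improve on \<open>H\<close>.\<close>
  have no_improve: False
    if uv: "u \<in> W" "v \<in> W" "(u, v) \<notin> parcs H" "parcs H `` {u} \<noteq> parcs H `` {v}" for u v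
  proof -
    define e where "e u v = card {\<phi> \<in> embeddings ?F H. v \<in> \<phi> ` V \<and> u \<notin> \<phi> ` V}" for u v
    have ok: "ok (clone H u v)" for u v
      using pair_graph_clone[OF H.pair_graph] by (simp add: ok_def VH)
    have sym: "(v, u) \<notin> parcs H" using uv(3) H.arcs_symmetric by blast
    have "u \<noteq> v" using uv(4) by auto
    have up: "card (embeddings ?F H) + e u v \<le> card (embeddings ?F (clone H u v)) + e v u"
      unfolding e_def using uv \<open>u \<noteq> v\<close>
      by (intro card_embeddings_clone[OF H.pair_graph assms(2)]) (simp_all add: VH)
    have down: "card (embeddings ?F H) + e v u \<le> card (embeddings ?F (clone H v u)) + e u v"
      unfolding e_def using uv \<open>u \<noteq> v\<close> sym
      by (intro card_embeddings_clone[OF H.pair_graph assms(2)]) (simp_all add: VH)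
    have eq: "e u v = e v u"
      using up down lex[OF ok[of u v]] lex[OF ok[of v u]] by linarith
    show False
    proof (cases "card (twins_of H u) \<le> card (twins_of H v)")
      case True
      then have "card (twin_pairs H) < card (twin_pairs (clone H u v))"
        using uv by (intro card_twin_pairs_clone[OF H.pair_graph]) (simp_all add: VH)
      then show ?thesis using up eq lex[OF ok[of u v]] by linarith
    next
      case False
      then have "card (twin_pairs H) < card (twin_pairs (clone H v u))"
        using uv by (intro card_twin_pairs_clone[OF H.pair_graph]) (simp_all add: VH)
      then show ?thesis using down eq lex[OF ok[of v u]] by linarith
    qed
  qed
  define d where "d x = (LEAST y. y \<in> W \<and> parcs H `` {y} = parcs H `` {x})" for x
  have d: "d x \<in> W" "parcs H `` {d x} = parcs H `` {x}" if "x \<in> W" for x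
    using LeastI[of "\<lambda>y. y \<in> W \<and> parcs H `` {y} = parcs H `` {x}" x] that
    unfolding d_def by auto
  have d_eq: "d x = d y \<longleftrightarrow> parcs H `` {x} = parcs H `` {y}" if "x \<in> W" "y \<in> W" for x y
  proof
    show "parcs H `` {x} = parcs H `` {y}" if "d x = d y"
      using d(2)[OF \<open>x \<in> W\<close>] d(2)[OF \<open>y \<in> W\<close>] that by simp
    show "d x = d y" if "parcs H `` {x} = parcs H `` {y}"
      unfolding d_def that ..
  qed
  have adj: "(x, y) \<in> parcs H \<longleftrightarrow> x \<in> W \<and> y \<in> W \<and> d x \<noteq> d y" for x y
  proof
    assume xy: "(x, y) \<in> parcs H"
    then have W: "x \<in> W" "y \<in> W" using H.in_arcsD1 H.in_arcsD2 VH by auto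
    have "(y, y) \<notin> parcs H" using H.no_loops' by blast
    then have "parcs H `` {x} \<noteq> parcs H `` {y}" using xy by blast
    then show "x \<in> W \<and> y \<in> W \<and> d x \<noteq> d y" using W d_eq by simp
  next
    assume "x \<in> W \<and> y \<in> W \<and> d x \<noteq> d y"
    then show "(x, y) \<in> parcs H" using no_improve[of x y] d_eq by blast
  qed
  have "H = partite_graph W d"
    by (rule pair_pre_digraph.equality) (auto simp: adj VH partite_graph_def)
  moreover have "card (embeddings ?F G) \<le> card (embeddings ?F H)"
    using lex[OF okG] by linarith
  moreover have "d ` W \<subseteq> W" using d by auto
  ultimately show ?thesis unfolding W_def by blast
qed

section \<open>Embeddings into complete multipartite graphs\<close>

lemma mem_embeddings_partite:
  "\<phi> \<in> embeddings (partite_graph V c) (partite_graph W d) \<longleftrightarrow>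
     \<phi> \<in> injections V W \<and> (\<forall>p\<in>V. \<forall>q\<in>V. c p \<noteq> c q \<longleftrightarrow> d (\<phi> p) \<noteq> d (\<phi> q))"
  by (auto simp: embeddings_def injections_def PiE_iff)

text \<open>
  With \<open>h p\<close> the colour of the image of \<open>p\<close>, this turns the condition for an embedding between
  complete multipartite graphs into the choice of an injection between their parts.
\<close>

lemma colouring_factors_iff:
  "(\<forall>p\<in>V. h p \<in> J) \<and> (\<forall>p\<in>V. \<forall>q\<in>V. c p \<noteq> c q \<longleftrightarrow> h p \<noteq> h q)
    \<longleftrightarrow> (\<exists>\<sigma>\<in>injections (c ` V) J. \<forall>p\<in>V. h p = \<sigma> (c p))" (is "?L \<longleftrightarrow> ?R")
proof
  assume L: ?L
  define \<sigma> where "\<sigma> = restrict (\<lambda>k. h (inv_into V c k)) (c ` V)"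
  have \<sigma>: "\<sigma> (c p) = h p" if "p \<in> V" for p
  proof -
    have "inv_into V c (c p) \<in> V" "c (inv_into V c (c p)) = c p"
      using that by (auto simp: inv_into_into f_inv_into_f)
    then have "h (inv_into V c (c p)) = h p" using L that by metis
    then show ?thesis using that by (simp add: \<sigma>_def)
  qed
  have "\<sigma> \<in> injections (c ` V) J"
    unfolding injections_def
  proof (intro CollectI conjI)
    show "\<sigma> \<in> c ` V \<rightarrow>\<^sub>E J" using L \<sigma> by (auto simp: PiE_iff extensional_def \<sigma>_def)
    show "inj_on \<sigma> (c ` V)" using L \<sigma> by (fastforce simp: inj_on_def)
  qed
  then show ?R by (rule bexI[rotated]) (simp add: \<sigma>)
next
  assume ?R
  then obtain \<sigma> where \<sigma>: "\<sigma> \<in> injections (c ` V) J" "\<And>p. p \<in> V \<Longrightarrow> h p = \<sigma> (c p)" by blast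
  then show ?L by (auto simp: injections_def PiE_iff inj_on_def)
qed

lemma injections_ext:
  assumes "\<sigma> \<in> injections (c ` V) J" "\<sigma>' \<in> injections (c ` V) J" "\<And>p. p \<in> V \<Longrightarrow> \<sigma> (c p) = \<sigma>' (c p)"
  shows "\<sigma> = \<sigma>'"
  by (rule PiE_ext[of _ "c ` V" "\<lambda>_. J"]) (use assms in \<open>auto simp: injections_def\<close>)

lemma labelled_density_vertexwise:
  assumes "finite V"
  shows "labelled_density (\<lambda>k. card {p \<in> V. c p = k}) (c ` V) J x
    = (\<Sum>\<sigma>\<in>injections (c ` V) J. \<Prod>p\<in>V. x (\<sigma> (c p)))"
  unfolding labelled_density_def
proof (rule sum.cong[OF refl])
  fix \<sigma>
  have "(\<Prod>p\<in>V. x (\<sigma> (c p))) = (\<Prod>k\<in>c ` V. \<Prod>p\<in>{p \<in> V. c p = k}. x (\<sigma> (c p)))"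
    by (rule prod.image_gen[OF assms])
  also have "\<dots> = (\<Prod>k\<in>c ` V. x (\<sigma> k) ^ card {p \<in> V. c p = k})"
  proof (rule prod.cong[OF refl])
    fix k
    have "(\<Prod>p\<in>{p \<in> V. c p = k}. x (\<sigma> (c p))) = (\<Prod>p\<in>{p \<in> V. c p = k}. x (\<sigma> k))"
      by (rule prod.cong) auto
    then show "(\<Prod>p\<in>{p \<in> V. c p = k}. x (\<sigma> (c p))) = x (\<sigma> k) ^ card {p \<in> V. c p = k}" by simp
  qed
  finally show "(\<Prod>k\<in>c ` V. x (\<sigma> k) ^ card {p \<in> V. c p = k}) = (\<Prod>p\<in>V. x (\<sigma> (c p)))" by simp
qed

text \<open>
  The bound counts all maps that send parts into distinct parts, including the non-injective ones.
  The proportion of these among all maps is exactly the labelled density of the relative part sizes.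
\<close>

lemma card_embeddings_partite_le:
  assumes fin: "finite V" "finite W" "finite J" and W: "W \<noteq> {}" "d ` W \<subseteq> J"
  shows "real (card (embeddings (partite_graph V c) (partite_graph W d)))
    \<le> real (card W) ^ card V * labelled_density (\<lambda>k. card {p \<in> V. c p = k}) (c ` V) J
          (\<lambda>j. real (card {w \<in> W. d w = j}) / real (card W))"
proof -
  let ?B = "\<lambda>\<sigma>. \<Pi>\<^sub>E p\<in>V. {w \<in> W. d w = \<sigma> (c p)}"
  let ?x = "\<lambda>j. real (card {w \<in> W. d w = j}) / real (card W)"
  have finI: "finite (injections (c ` V) J)" using fin by (intro finite_injections) auto
  have n0: "real (card W) \<noteq> 0" using fin W by auto
  have "embeddings (partite_graph V c) (partite_graph W d) \<subseteq> (\<Union>\<sigma>\<in>injections (c ` V) J. ?B \<sigma>)"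
  proof
    fix \<phi> assume "\<phi> \<in> embeddings (partite_graph V c) (partite_graph W d)"
    then have \<phi>: "\<phi> \<in> injections V W" "\<forall>p\<in>V. \<forall>q\<in>V. c p \<noteq> c q \<longleftrightarrow> d (\<phi> p) \<noteq> d (\<phi> q)"
      by (auto simp: mem_embeddings_partite)
    have "\<forall>p\<in>V. d (\<phi> p) \<in> J" using \<phi>(1) W(2) by (auto simp: injections_def PiE_iff)
    then obtain \<sigma> where "\<sigma> \<in> injections (c ` V) J" "\<forall>p\<in>V. d (\<phi> p) = \<sigma> (c p)"
      using \<phi>(2) colouring_factors_iff[of V "\<lambda>p. d (\<phi> p)" J c] by auto
    then show "\<phi> \<in> (\<Union>\<sigma>\<in>injections (c ` V) J. ?B \<sigma>)"
      using \<phi>(1) by (auto simp: injections_def PiE_iff)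
  qed
  then have "card (embeddings (partite_graph V c) (partite_graph W d))
      \<le> card (\<Union>\<sigma>\<in>injections (c ` V) J. ?B \<sigma>)"
    using fin finI by (intro card_mono) (auto intro!: finite_PiE)
  also have "\<dots> \<le> (\<Sum>\<sigma>\<in>injections (c ` V) J. card (?B \<sigma>))" by (rule card_UN_le[OF finI])
  also have "\<dots> = (\<Sum>\<sigma>\<in>injections (c ` V) J. \<Prod>p\<in>V. card {w \<in> W. d w = \<sigma> (c p)})"
    using fin by (simp add: card_PiE)
  finally have "real (card (embeddings (partite_graph V c) (partite_graph W d)))
      \<le> real (\<Sum>\<sigma>\<in>injections (c ` V) J. \<Prod>p\<in>V. card {w \<in> W. d w = \<sigma> (c p)})"
    by (rule of_nat_mono)
  also have "\<dots> = (\<Sum>\<sigma>\<in>injections (c ` V) J. \<Prod>p\<in>V. real (card W) * ?x (\<sigma> (c p)))"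
    using n0 by simp
  also have "\<dots> = real (card W) ^ card V * (\<Sum>\<sigma>\<in>injections (c ` V) J. \<Prod>p\<in>V. ?x (\<sigma> (c p)))"
    by (simp only: prod.distrib prod_constant sum_distrib_left)
  finally show ?thesis using labelled_density_vertexwise[OF fin(1), of c J ?x] by simp
qed

lemma clique_free_partite_graph:
  assumes "finite W" "finite J" "d ` W \<subseteq> J" "card J < k"
  shows "clique_free k (partite_graph W d)"
  unfolding clique_free_def
proof clarify
  fix H :: "('a, 'a \<times> 'a) pre_digraph"
  assume sub: "subgraph H (with_proj (partite_graph W d))" and K: "complete_digraph k H"
  have VH: "verts H \<subseteq> W" using sub by (simp add: subgraph_def)
  have "inj_on d (verts H)"
  proof (rule inj_onI, rule ccontr)
    fix u v assume uv: "u \<in> verts H" "v \<in> verts H" "d u = d v" "u \<noteq> v"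
    then have "(u, v) \<in> arcs_ends H" using K by (auto simp: complete_digraph_def)
    then have "(u, v) \<in> parcs (partite_graph W d)" using arcs_ends_mono[OF sub] by auto
    then show False using uv by simp
  qed
  moreover have "d ` verts H \<subseteq> J" using VH assms(3) by auto
  ultimately have "card (verts H) \<le> card J" using assms(2) by (rule card_inj_on_le)
  then show False using K assms(4) by (simp add: complete_digraph_def)
qed

lemma real_card_injections:
  assumes "finite V" "card V \<le> n"
  shows "real (card (injections V {..<n})) = fact (card V) * real (n choose card V)"
proof -
  have "card (injections V {..<n}) = (\<Prod>i = 0..<card V. n - i)"
    using card_inj_on_subset_funcset[OF assms(1), of "{..<n}" V] by (simp add: injections_def)
  then have "real (card (injections V {..<n})) = (\<Prod>i = 0..<card V. real n - real i)"
    using assms(2) by (simp add: of_nat_diff)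
  also have "\<dots> = fact (card V) * (real n gchoose card V)" by (rule gbinomial_mult_fact[symmetric])
  finally show ?thesis by (simp add: binomial_gbinomial)
qed

lemma tendsto_power_div_binomial:
  "(\<lambda>n. real n ^ k / (fact k * real (n choose k))) \<longlonglongrightarrow> 1"
proof -
  have "(\<lambda>n. \<Prod>i = 0..<k. (real n - real i) / real n) \<longlonglongrightarrow> (\<Prod>i = 0..<k. 1)"
  proof (rule tendsto_prod)
    fix i
    show "(\<lambda>n. (real n - real i) / real n) \<longlonglongrightarrow> 1" by real_asymp
  qed
  then have "(\<lambda>n. inverse (\<Prod>i = 0..<k. (real n - real i) / real n)) \<longlonglongrightarrow> inverse 1"
    by (intro tendsto_inverse) auto
  moreover have "inverse (\<Prod>i = 0..<k. (real n - real i) / real n)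
      = real n ^ k / (fact k * real (n choose k))" for n
  proof -
    have "fact k * real (n choose k) = (\<Prod>i = 0..<k. real n - real i)"
      using gbinomial_mult_fact[of k "real n"] by (simp add: binomial_gbinomial)
    then show ?thesis by (simp add: prod_dividef inverse_eq_divide)
  qed
  ultimately show ?thesis by simp
qed

section \<open>Sampling from a complete partite graphon\<close>

lemma graphon_part_unique:
  assumes "partite_weights l x" "i \<in> {1..l}" "j \<in> {1..l}" "u \<in> graphon_part l x i" "u \<in> graphon_part l x j"
  shows "i = j"
proof -
  have False if "i < j" "i \<in> {1..l}" "j \<in> {1..l}" "u \<in> graphon_part l x i" "u \<in> graphon_part l x j" for i j
  proof -
    have "u < sum x {1..i}" using that by (auto simp: graphon_part_def)
    also have "\<dots> \<le> sum x {1..<j}"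
      using that assms(1) by (intro sum_mono2) (auto simp: partite_weights_def intro: less_imp_le)
    also have "\<dots> \<le> u" using that by (auto simp: graphon_part_def split: if_splits)
    finally show False by simp
  qed
  then show ?thesis using assms by (metis linorder_neqE_nat)
qed

lemma graphon_part_cover:
  assumes "partite_weights l x" "u \<in> {0..1}"
  shows "\<exists>i\<in>{1..l}. u \<in> graphon_part l x i"
proof (cases "u = 1")
  case True
  have "l \<noteq> 0" by (rule notI) (use assms in \<open>simp add: partite_weights_def\<close>)
  then have l: "l \<in> {1..l}" by simp
  have "sum x {1..<l} \<le> sum x {1..l}"
    using assms by (intro sum_mono2) (auto simp: partite_weights_def intro: less_imp_le)
  then have "u \<in> graphon_part l x l"
    using True assms by (simp add: graphon_part_def partite_weights_def)
  then show ?thesis using l by blast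
next
  case False
  then have ul: "u < sum x {1..l}" using assms by (simp add: partite_weights_def)
  define i where "i = (LEAST i. u < sum x {1..i})"
  have i: "u < sum x {1..i}" "i \<le> l"
    unfolding i_def using LeastI[of "\<lambda>i. u < sum x {1..i}", OF ul]
      Least_le[of "\<lambda>i. u < sum x {1..i}", OF ul] by auto
  have "i \<noteq> 0" by (rule notI) (use i(1) assms(2) in simp)
  then have "\<not> u < sum x {1..i - 1}"
    unfolding i_def by (intro not_less_Least) (simp add: i_def[symmetric])
  moreover have "{1..i - 1} = {1..<i}" using \<open>i \<noteq> 0\<close> by auto
  ultimately have "sum x {1..<i} \<le> u" by simp
  then have "u \<in> graphon_part l x i" using i(1) unfolding graphon_part_def by auto
  then show ?thesis using i \<open>i \<noteq> 0\<close> by (intro bexI[of _ i]) auto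
qed

definition point_colour :: "nat \<Rightarrow> (nat \<Rightarrow> real) \<Rightarrow> real \<Rightarrow> nat" where
  "point_colour l x u = (THE i. i \<in> {1..l} \<and> u \<in> graphon_part l x i)"

lemma point_colour_eq_iff:
  assumes "partite_weights l x" "u \<in> {0..1}"
  shows "i \<in> {1..l} \<and> u \<in> graphon_part l x i \<longleftrightarrow> i = point_colour l x u"
proof -
  have "\<exists>!i. i \<in> {1..l} \<and> u \<in> graphon_part l x i"
    using graphon_part_cover[OF assms] graphon_part_unique[OF assms(1)] by blast
  from theI'[OF this] this show ?thesis unfolding point_colour_def by blast
qed

lemma sample_graph_eq_partite_graph:
  assumes "partite_weights l x" "\<And>k. k < n \<Longrightarrow> u k \<in> {0..1}"
  shows "sample_graph (partite_graphon l x) n u = partite_graph {..<n} (\<lambda>k. point_colour l x (u k))"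
proof -
  have "partite_graphon l x (u i) (u j) = 1 \<longleftrightarrow> point_colour l x (u i) \<noteq> point_colour l x (u j)"
    if "i < n" "j < n" for i j
  proof -
    have "partite_graphon l x (u i) (u j) = 1 \<longleftrightarrow>
        (\<exists>a b. (a \<in> {1..l} \<and> u i \<in> graphon_part l x a) \<and> (b \<in> {1..l} \<and> u j \<in> graphon_part l x b) \<and> a \<noteq> b)"
      unfolding partite_graphon_def by (simp add: Bex_def) blast
    also have "\<dots> \<longleftrightarrow> point_colour l x (u i) \<noteq> point_colour l x (u j)"
      unfolding point_colour_eq_iff[OF assms(1) assms(2)[OF that(1)]]
        point_colour_eq_iff[OF assms(1) assms(2)[OF that(2)]] by simp
    finally show ?thesis .
  qed
  then show ?thesis unfolding sample_graph_def partite_graph_def by auto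
qed

abbreviation unif :: "real measure" where
  "unif \<equiv> uniform_measure lborel {0..1}"

lemma prob_space_unif: "prob_space unif"
  by (rule prob_space_uniform_measure) simp_all

lemma measure_graphon_part:
  assumes "partite_weights l x" "i \<in> {1..l}"
  shows "measure unif (graphon_part l x i) = x i"
proof -
  have ge0: "0 \<le> sum x {1..<i}"
    using assms by (intro sum_nonneg) (auto simp: partite_weights_def intro: less_imp_le)
  have "{1..i} = insert i {1..<i}" using assms(2) by auto
  then have S: "sum x {1..i} = x i + sum x {1..<i}" by simp
  have "sum x {1..i} \<le> sum x {1..l}"
    using assms by (intro sum_mono2) (auto simp: partite_weights_def intro: less_imp_le)
  then have le1: "sum x {1..i} \<le> 1" using assms by (simp add: partite_weights_def)
  have xi: "0 \<le> x i" using assms by (auto simp: partite_weights_def intro: less_imp_le)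
  have "{0..1} \<inter> graphon_part l x i = graphon_part l x i"
    using ge0 le1 by (auto simp: graphon_part_def split: if_splits)
  then have "measure unif (graphon_part l x i) = measure lborel (graphon_part l x i)"
    by (subst measure_uniform_measure) (auto simp: graphon_part_def)
  also have "\<dots> = x i"
  proof -
    have "graphon_part l x i = {sum x {1..<i}..x i + sum x {1..<i}}
        \<or> graphon_part l x i = {sum x {1..<i}..<x i + sum x {1..<i}}"
      unfolding graphon_part_def S by simp
    moreover have "measure lborel {a..x i + a} = x i" "measure lborel {a..<x i + a} = x i" for a
      using xi by (simp_all add: measure_def)
    ultimately show ?thesis by metis
  qed
  finally show ?thesis .
qed

abbreviation iid_unif :: "nat \<Rightarrow> (nat \<Rightarrow> real) measure" where
  "iid_unif n \<equiv> Pi\<^sub>M {..<n} (\<lambda>_. unif)"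

lemma finite_product_prob_space_unif: "finite_product_prob_space (\<lambda>_. unif) {..<n::nat}"
proof -
  interpret product_prob_space "\<lambda>_::nat. unif" by (rule product_prob_spaceI) (rule prob_space_unif)
  show ?thesis by unfold_locales simp
qed

lemma AE_iid_unif_unit: "AE u in iid_unif n. \<forall>k<n. u k \<in> {0..1}"
proof -
  interpret finite_product_prob_space "\<lambda>_. unif" "{..<n}" by (rule finite_product_prob_space_unif)
  have "AE u in iid_unif n. u k \<in> {0..1}" if "k \<in> {..<n}" for k
    using that by (intro AE_component AE_uniform_measureI) auto
  then have "AE u in iid_unif n. \<forall>k\<in>{..<n}. u k \<in> {0..1}"
    by (intro AE_finite_allI) auto
  then show ?thesis by (simp add: Ball_def)
qed

text \<open>
  Up to the null set where some point lies outside \<open>[0, 1]\<close>, the event is a disjoint union of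
  boxes, one for each injection \<open>\<sigma>\<close> of the parts into the intervals, and the box of \<open>\<sigma>\<close> has
  the product of the interval lengths as its measure.
\<close>

lemma prob_embedding_sample_graph:
  fixes c :: "'f \<Rightarrow> 'c" and \<phi> :: "'f \<Rightarrow> nat"
  assumes w: "partite_weights l x" and V: "finite V" and \<phi>: "\<phi> \<in> injections V {..<n}"
  defines "E \<equiv> {u \<in> space (iid_unif n).
      \<phi> \<in> embeddings (partite_graph V c) (sample_graph (partite_graphon l x) n u)}"
  shows "E \<in> sets (iid_unif n)"
    and "measure (iid_unif n) E
      = labelled_density (\<lambda>k. card {p \<in> V. c p = k}) (c ` V) {1..l} x"
proof -
  interpret finite_product_prob_space "\<lambda>_. unif" "{..<n}" by (rule finite_product_prob_space_unif)
  let ?part = "graphon_part l x"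
  have \<phi>n: "\<phi> p < n" if "p \<in> V" for p using \<phi> that by (auto simp: injections_def PiE_iff)
  have inj: "inj_on \<phi> V" using \<phi> by (simp add: injections_def)
  have part: "?part i \<in> sets borel" for i by (simp add: graphon_part_def)
  have coord: "Measurable.pred (iid_unif n) (\<lambda>u. u (\<phi> p) \<in> ?part i)" if "p \<in> V" for p i
  proof -
    have "(\<lambda>u. u (\<phi> p)) \<in> measurable (iid_unif n) unif"
      by (rule measurable_component_singleton) (use \<phi>n that in auto)
    then show ?thesis by (rule pred_sets2[rotated]) (use part in auto)
  qed
  have E_eq: "E = {u \<in> space (iid_unif n). \<forall>p\<in>V. \<forall>q\<in>V. c p \<noteq> c q \<longleftrightarrow>
      (\<phi> p \<noteq> \<phi> q \<and> (\<exists>i\<in>{1..l}. \<exists>j\<in>{1..l}. i \<noteq> j \<and> u (\<phi> p) \<in> ?part i \<and> u (\<phi> q) \<in> ?part j))}"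
  proof -
    have "\<phi> \<in> embeddings (partite_graph V c) (sample_graph W n u) \<longleftrightarrow>
        (\<forall>p\<in>V. \<forall>q\<in>V. c p \<noteq> c q \<longleftrightarrow> (\<phi> p \<noteq> \<phi> q \<and> W (u (\<phi> p)) (u (\<phi> q)) = 1))" for W u
      using \<phi> \<phi>n by (simp add: embeddings_def sample_graph_def injections_def)
    moreover have "partite_graphon l x a b = 1 \<longleftrightarrow>
        (\<exists>i\<in>{1..l}. \<exists>j\<in>{1..l}. i \<noteq> j \<and> a \<in> ?part i \<and> b \<in> ?part j)" for a b
      unfolding partite_graphon_def by simp
    ultimately show ?thesis unfolding E_def by simp
  qed
  have "Measurable.pred (iid_unif n) (\<lambda>u. \<forall>p\<in>V. \<forall>q\<in>V. c p \<noteq> c q \<longleftrightarrow>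
      (\<phi> p \<noteq> \<phi> q \<and> (\<exists>i\<in>{1..l}. \<exists>j\<in>{1..l}. i \<noteq> j \<and> u (\<phi> p) \<in> ?part i \<and> u (\<phi> q) \<in> ?part j)))"
    using V by (intro pred_intros_finite pred_intros_logic coord) auto
  then show E_sets: "E \<in> sets (iid_unif n)" unfolding E_eq by (simp add: pred_def)
  define \<Sigma> where "\<Sigma> = injections (c ` V) {1..l}"
  define box where "box \<sigma> = {u \<in> space (iid_unif n). \<forall>p\<in>V. u (\<phi> p) \<in> ?part (\<sigma> (c p))}" for \<sigma>
  have fin\<Sigma>: "finite \<Sigma>" unfolding \<Sigma>_def using V by (intro finite_injections) auto
  have \<Sigma>: "\<sigma> (c p) \<in> {1..l}" if "\<sigma> \<in> \<Sigma>" "p \<in> V" for \<sigma> p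
    using that by (auto simp: \<Sigma>_def injections_def PiE_iff)
  have prob_box: "box \<sigma> \<in> sets (iid_unif n)" "measure (iid_unif n) (box \<sigma>) = (\<Prod>p\<in>V. x (\<sigma> (c p)))"
    if "\<sigma> \<in> \<Sigma>" for \<sigma>
  proof -
    define A where "A k = (if k \<in> \<phi> ` V then ?part (\<sigma> (c (the_inv_into V \<phi> k))) else UNIV)" for k
    have A\<phi>: "A (\<phi> p) = ?part (\<sigma> (c p))" if "p \<in> V" for p
      using that the_inv_into_f_f[OF inj] by (simp add: A_def)
    have A_sets: "A k \<in> sets unif" for k using part by (simp add: A_def)
    have "u \<in> box \<sigma> \<longleftrightarrow> u \<in> Pi\<^sub>E {..<n} A" for u
    proof -
      have "(\<forall>k<n. u k \<in> A k) \<longleftrightarrow> (\<forall>p\<in>V. u (\<phi> p) \<in> ?part (\<sigma> (c p)))"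
      proof
        assume "\<forall>k<n. u k \<in> A k"
        then show "\<forall>p\<in>V. u (\<phi> p) \<in> ?part (\<sigma> (c p))" using A\<phi> \<phi>n by metis
      next
        assume R: "\<forall>p\<in>V. u (\<phi> p) \<in> ?part (\<sigma> (c p))"
        show "\<forall>k<n. u k \<in> A k"
        proof (intro allI impI)
          fix k
          show "u k \<in> A k"
          proof (cases "k \<in> \<phi> ` V")
            case True
            then show ?thesis using R A\<phi> by auto
          qed (simp add: A_def)
        qed
      qed
      then show ?thesis by (auto simp: box_def space_PiM PiE_iff)
    qed
    then have box: "box \<sigma> = Pi\<^sub>E {..<n} A" by blast
    show "box \<sigma> \<in> sets (iid_unif n)"
      unfolding box using A_sets by (intro sets_PiM_I_finite) auto
    have "measure (iid_unif n) (box \<sigma>) = (\<Prod>k<n. measure unif (A k))"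
      unfolding box using A_sets by (intro finite_measure_PiM_emb)
    also have "\<dots> = (\<Prod>k\<in>\<phi> ` V. measure unif (A k))"
    proof (rule prod.mono_neutral_right)
      show "\<forall>k\<in>{..<n} - \<phi> ` V. measure unif (A k) = 1"
        using prob_space.prob_space[OF prob_space_unif] by (simp add: A_def)
    qed (use \<phi>n in auto)
    also have "\<dots> = (\<Prod>p\<in>V. measure unif (A (\<phi> p)))" using inj by (simp add: prod.reindex)
    also have "\<dots> = (\<Prod>p\<in>V. x (\<sigma> (c p)))"
      using A\<phi> \<Sigma>[OF that] measure_graphon_part[OF w] by (intro prod.cong) auto
    finally show "measure (iid_unif n) (box \<sigma>) = (\<Prod>p\<in>V. x (\<sigma> (c p)))" .
  qed
  have E_box: "u \<in> E \<longleftrightarrow> u \<in> (\<Union>\<sigma>\<in>\<Sigma>. box \<sigma>)"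
    if u: "u \<in> space (iid_unif n)" "\<forall>k<n. u k \<in> {0..1}" for u
  proof -
    let ?d = "\<lambda>k. point_colour l x (u k)"
    have pc: "i \<in> {1..l} \<and> u (\<phi> p) \<in> ?part i \<longleftrightarrow> i = ?d (\<phi> p)" if "p \<in> V" for p i
      using point_colour_eq_iff[OF w, of "u (\<phi> p)" i] u(2) \<phi>n[OF that] by blast
    have "u \<in> E \<longleftrightarrow> \<phi> \<in> embeddings (partite_graph V c) (partite_graph {..<n} ?d)"
      using u sample_graph_eq_partite_graph[OF w, of n u] by (simp add: E_def)
    also have "\<dots> \<longleftrightarrow> (\<forall>p\<in>V. ?d (\<phi> p) \<in> {1..l}) \<and> (\<forall>p\<in>V. \<forall>q\<in>V. c p \<noteq> c q \<longleftrightarrow> ?d (\<phi> p) \<noteq> ?d (\<phi> q))"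
      using \<phi> pc unfolding mem_embeddings_partite by blast
    also have "\<dots> \<longleftrightarrow> (\<exists>\<sigma>\<in>\<Sigma>. \<forall>p\<in>V. ?d (\<phi> p) = \<sigma> (c p))"
      unfolding \<Sigma>_def by (rule colouring_factors_iff)
    also have "\<dots> \<longleftrightarrow> (\<exists>\<sigma>\<in>\<Sigma>. \<forall>p\<in>V. u (\<phi> p) \<in> ?part (\<sigma> (c p)))"
    proof (rule bex_cong[OF refl], rule ball_cong[OF refl])
      fix \<sigma> p assume "\<sigma> \<in> \<Sigma>" "p \<in> V"
      then show "?d (\<phi> p) = \<sigma> (c p) \<longleftrightarrow> u (\<phi> p) \<in> ?part (\<sigma> (c p))"
        using pc[of p "\<sigma> (c p)"] \<Sigma>[of \<sigma> p] by auto
    qed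
    finally show ?thesis using u(1) by (simp add: box_def)
  qed
  have "measure (iid_unif n) E = measure (iid_unif n) (\<Union>\<sigma>\<in>\<Sigma>. box \<sigma>)"
  proof (rule finite_measure_eq_AE)
    show "AE u in iid_unif n. u \<in> E \<longleftrightarrow> u \<in> (\<Union>\<sigma>\<in>\<Sigma>. box \<sigma>)"
      using AE_iid_unif_unit[of n] AE_space
    proof eventually_elim
      case (elim u)
      then show ?case using E_box by blast
    qed
    show "(\<Union>\<sigma>\<in>\<Sigma>. box \<sigma>) \<in> sets (iid_unif n)"
      using fin\<Sigma> prob_box(1) by (intro sets.finite_UN) auto
  qed (rule E_sets)
  also have "\<dots> = (\<Sum>\<sigma>\<in>\<Sigma>. measure (iid_unif n) (box \<sigma>))"
  proof (rule finite_measure_finite_Union[OF fin\<Sigma>])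
    show "box ` \<Sigma> \<subseteq> sets (iid_unif n)" using prob_box(1) by auto
    show "disjoint_family_on box \<Sigma>"
      unfolding disjoint_family_on_def
    proof (intro ballI impI, rule ccontr)
      fix \<sigma> \<sigma>' assume s: "\<sigma> \<in> \<Sigma>" "\<sigma>' \<in> \<Sigma>" "\<sigma> \<noteq> \<sigma>'" "box \<sigma> \<inter> box \<sigma>' \<noteq> {}"
      then obtain u where u: "u \<in> box \<sigma>" "u \<in> box \<sigma>'" by blast
      have "\<sigma> = \<sigma>'"
      proof (rule injections_ext)
        fix p assume p: "p \<in> V"
        show "\<sigma> (c p) = \<sigma>' (c p)"
          using u p by (intro graphon_part_unique[OF w \<Sigma>[OF s(1) p] \<Sigma>[OF s(2) p], of "u (\<phi> p)"])
            (auto simp: box_def)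
      qed (use s in \<open>auto simp: \<Sigma>_def\<close>)
      then show False using s(3) by simp
    qed
  qed
  also have "\<dots> = (\<Sum>\<sigma>\<in>\<Sigma>. \<Prod>p\<in>V. x (\<sigma> (c p)))" using prob_box(2) by simp
  finally show "measure (iid_unif n) E
      = labelled_density (\<lambda>k. card {p \<in> V. c p = k}) (c ` V) {1..l} x"
    unfolding labelled_density_vertexwise[OF V] \<Sigma>_def .
qed

text \<open>
  Linearity of expectation: each injective map is an embedding with the same probability.
\<close>

lemma expected_embeddings_sample_graph:
  fixes c :: "'f \<Rightarrow> 'c" and n :: nat
  assumes w: "partite_weights l x" and V: "finite V"
  defines "X \<equiv> \<lambda>u. real (card (embeddings (partite_graph V c) (sample_graph (partite_graphon l x) n u)))"
  shows "integrable (iid_unif n) X"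
    and "integral\<^sup>L (iid_unif n) X = real (card (injections V {..<n}))
      * labelled_density (\<lambda>k. card {p \<in> V. c p = k}) (c ` V) {1..l} x"
proof -
  interpret finite_product_prob_space "\<lambda>_. unif" "{..<n}" by (rule finite_product_prob_space_unif)
  define I where "I = injections V {..<n}"
  define E where "E \<phi> = {u \<in> space (iid_unif n).
      \<phi> \<in> embeddings (partite_graph V c) (sample_graph (partite_graphon l x) n u)}" for \<phi>
  have finI: "finite I" unfolding I_def using V by (intro finite_injections) auto
  have E: "E \<phi> \<in> sets (iid_unif n)" "measure (iid_unif n) (E \<phi>)
      = labelled_density (\<lambda>k. card {p \<in> V. c p = k}) (c ` V) {1..l} x" if "\<phi> \<in> I" for \<phi>
    using prob_embedding_sample_graph[OF w V that[unfolded I_def]] by (simp_all add: E_def)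
  have X: "X u = (\<Sum>\<phi>\<in>I. indicator (E \<phi>) u)" if "u \<in> space (iid_unif n)" for u
  proof -
    have "embeddings (partite_graph V c) (sample_graph (partite_graphon l x) n u) = {\<phi> \<in> I. u \<in> E \<phi>}"
      using that by (auto simp: I_def E_def embeddings_def injections_def sample_graph_def)
    then have "X u = real (card {\<phi> \<in> I. u \<in> E \<phi>})" by (simp add: X_def)
    also have "\<dots> = (\<Sum>\<phi>\<in>I. if u \<in> E \<phi> then 1 else 0)"
      using finI by (simp add: sum.If_cases Int_def)
    finally show ?thesis by (simp add: indicator_def of_bool_def)
  qed
  have int: "integrable (iid_unif n) (\<lambda>u. indicator (E \<phi>) u :: real)" if "\<phi> \<in> I" for \<phi>
    using E(1)[OF that] by (simp add: emeasure_finite less_top[symmetric])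
  show "integrable (iid_unif n) X"
    using int by (subst Bochner_Integration.integrable_cong[OF refl X]) auto
  have "integral\<^sup>L (iid_unif n) X = integral\<^sup>L (iid_unif n) (\<lambda>u. \<Sum>\<phi>\<in>I. indicator (E \<phi>) u)"
    by (rule Bochner_Integration.integral_cong[OF refl X])
  also have "\<dots> = (\<Sum>\<phi>\<in>I. integral\<^sup>L (iid_unif n) (indicator (E \<phi>)))"
    using int by (rule Bochner_Integration.integral_sum)
  also have "\<dots> = (\<Sum>\<phi>\<in>I. measure (iid_unif n) (E \<phi>))"
    using E(1) sets.sets_into_space by (intro sum.cong refl) (simp add: Int_absorb2)
  finally show "integral\<^sup>L (iid_unif n) X = real (card (injections V {..<n}))
      * labelled_density (\<lambda>k. card {p \<in> V. c p = k}) (c ` V) {1..l} x"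
    using E(2) by (simp add: I_def)
qed

text \<open>
  Some sample does at least as well as the average; one with all points in \<open>[0, 1]\<close> can be chosen,
  since the others form a null set.
\<close>

lemma ex_sample_graph_many_embeddings:
  assumes w: "partite_weights l x" and V: "finite V"
  shows "\<exists>d. d ` {..<n} \<subseteq> {1..l} \<and> real (card (injections V {..<n}))
      * labelled_density (\<lambda>k. card {p \<in> V. c p = k}) (c ` V) {1..l} x
      \<le> real (card (embeddings (partite_graph V c) (partite_graph {..<n::nat} d)))"
proof -
  interpret finite_product_prob_space "\<lambda>_. unif" "{..<n}" by (rule finite_product_prob_space_unif)
  let ?X = "\<lambda>u. real (card (embeddings (partite_graph V c) (sample_graph (partite_graphon l x) n u)))"
  let ?m = "real (card (injections V {..<n}))
      * labelled_density (\<lambda>k. card {p \<in> V. c p = k}) (c ` V) {1..l} x"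
  have "\<not> (AE u in iid_unif n. ?X u < ?m)"
    using expectation_less[OF expected_embeddings_sample_graph(1)[OF w V, where c = c and n = n], of ?m]
      expected_embeddings_sample_graph(2)[OF w V, where c = c and n = n] by auto
  then obtain u where u: "\<forall>k<n. u k \<in> {0..1}" "?m \<le> ?X u"
  proof (rule contrapos_np)
    assume none: "\<not> thesis"
    show "AE u in iid_unif n. ?X u < ?m"
      using AE_iid_unif_unit[of n]
    proof eventually_elim
      case (elim u)
      then show ?case using none that[of u] by force
    qed
  qed
  have "point_colour l x (u k) \<in> {1..l}" if "k < n" for k
    using point_colour_eq_iff[OF w, of "u k" "point_colour l x (u k)"] u(1) that by blast
  moreover have "sample_graph (partite_graphon l x) n u = partite_graph {..<n} (\<lambda>k. point_colour l x (u k))"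
    using u(1) by (intro sample_graph_eq_partite_graph[OF w]) auto
  ultimately show ?thesis using u(2) by (intro exI[of _ "\<lambda>k. point_colour l x (u k)"]) auto
qed

section \<open>Inducibility\<close>

lemma automorphisms_pos:
  assumes "finite (pverts F)"
  shows "0 < card (embeddings F F)"
proof -
  have "finite (embeddings F F)" using finite_embeddings[OF assms assms] .
  moreover have "restrict id (pverts F) \<in> embeddings F F"
    by (auto simp: embeddings_def inj_on_def)
  ultimately show ?thesis by (auto simp: card_gt_0_iff)
qed

lemma ind_density_eq_embeddings:
  assumes "pair_graph F" "pair_graph G"
  shows "ind_density F G = real (card (embeddings F G))
    / (real (card (embeddings F F)) * real (card (pverts G) choose card (pverts F)))"
proof -
  have "finite (pverts F)" using assms(1)
    by (simp add: pair_graph_def pair_digraph_def pair_fin_digraph.pair_finite_verts)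
  then show ?thesis
    using automorphisms_pos[of F] card_embeddings[OF assms] by (simp add: ind_density_def)
qed

text \<open>
  For a sample of \<open>card V\<close> points the number of embeddings is the number of automorphisms if the
  sample is isomorphic to \<open>F\<close>, and zero otherwise.
\<close>

lemma graphon_ind_density_partite:
  fixes c :: "'f \<Rightarrow> 'c"
  assumes w: "partite_weights l x" and V: "finite V"
  defines "F \<equiv> partite_graph V c"
  shows "graphon_ind_density F (partite_graphon l x) = fact (card V)
    * labelled_density (\<lambda>k. card {p \<in> V. c p = k}) (c ` V) {1..l} x / real (card (embeddings F F))"
proof -
  let ?n = "card V"
  interpret finite_product_prob_space "\<lambda>_. unif" "{..<?n}" by (rule finite_product_prob_space_unif)
  let ?G = "sample_graph (partite_graphon l x) ?n"
  let ?A = "card (embeddings F F)"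
  define S where "S = {u \<in> space (iid_unif ?n). digraph_iso (with_proj (?G u)) (with_proj F)}"
  have F: "pair_graph F" "pverts F = V" using V by (simp_all add: F_def pair_graph_partite_graph)
  have emb: "real (card (embeddings F (?G u))) = real ?A * indicator S u"
    if u: "u \<in> space (iid_unif ?n)" "\<forall>k<?n. u k \<in> {0..1}" for u
  proof -
    have "?G u = partite_graph {..<?n} (\<lambda>k. point_colour l x (u k))"
      using u(2) by (intro sample_graph_eq_partite_graph[OF w]) auto
    then have G: "pair_graph (?G u)" "pverts (?G u) = {..<?n}" by (simp_all add: pair_graph_partite_graph)
    have whole: "with_proj (?G u) \<restriction> {..<?n} = with_proj (?G u)"
      by (rule pre_digraph.equality) (auto simp: sample_graph_def)
    have full: "S' \<subseteq> {..<?n} \<and> card S' = ?n \<longleftrightarrow> S' = {..<?n}" for S' :: "nat set"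
      using card_subset_eq[of "{..<?n}" S'] by auto
    have "{S'. S' \<subseteq> pverts (?G u) \<and> card S' = card (pverts F)
              \<and> digraph_iso (with_proj (?G u) \<restriction> S') (with_proj F)}
        = {S'. S' = {..<?n} \<and> digraph_iso (with_proj (?G u) \<restriction> S') (with_proj F)}"
      unfolding G(2) F(2) conj_assoc[symmetric] full ..
    also have "\<dots> = (if u \<in> S then {{..<?n}} else {})"
      using u(1) whole by (auto simp: S_def)
    finally have "ind_count F (?G u) = (if u \<in> S then 1 else 0)"
      by (simp add: ind_count_def)
    then show ?thesis using card_embeddings[OF F(1) G(1)] by simp
  qed
  let ?X = "\<lambda>u. real (card (embeddings F (?G u)))"
  have int: "integrable (iid_unif ?n) ?X"
    unfolding F_def by (rule expected_embeddings_sample_graph(1)[OF w V])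
  have A: "0 < ?A" using V F by (simp add: automorphisms_pos)
  have S_sets: "S \<in> sets (iid_unif ?n)"
  proof -
    have "{u \<in> space (iid_unif ?n). digraph_iso (with_proj (?G u)) (with_proj F)}
       = {u \<in> space (iid_unif ?n). 0 < ?X u}"
    proof (rule Collect_cong, rule conj_cong[OF refl])
      fix u
      have wf: "pair_wf_digraph (?G u)" "pair_wf_digraph F"
        using F(1) by (unfold_locales; auto simp: sample_graph_def F_def)+
      have whole: "with_proj (?G u) \<restriction> {..<?n} = with_proj (?G u)"
        by (rule pre_digraph.equality) (auto simp: sample_graph_def)
      have fin: "finite (embeddings F (?G u))"
        using V by (intro finite_embeddings) (auto simp: F sample_graph_def)
      have "\<phi> ` V = {..<?n}" if "\<phi> \<in> embeddings F (?G u)" for \<phi>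
        using that V by (intro card_subset_eq) (auto simp: embeddings_def F sample_graph_def card_image)
      then have "(\<exists>\<phi>\<in>embeddings F (?G u). \<phi> ` pverts F = {..<?n}) \<longleftrightarrow> 0 < ?X u"
        using fin by (auto simp: F card_gt_0_iff)
      moreover have "{..<?n} \<subseteq> pverts (?G u)" by (simp add: sample_graph_def)
      ultimately show "digraph_iso (with_proj (?G u)) (with_proj F) \<longleftrightarrow> 0 < ?X u"
        using digraph_iso_induced_iff[OF wf(2,1), of "{..<?n}"] unfolding whole by blast
    qed
    moreover have "{u \<in> space (iid_unif ?n). 0 < ?X u} \<in> sets (iid_unif ?n)"
      by (rule borel_measurable_less[OF borel_measurable_const borel_measurable_integrable[OF int]])
    ultimately show ?thesis unfolding S_def by (simp only:)
  qed
  have "integral\<^sup>L (iid_unif ?n) ?X = integral\<^sup>L (iid_unif ?n) (\<lambda>u. real ?A * indicator S u)"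
  proof (rule integral_cong_AE)
    show "AE u in iid_unif ?n. ?X u = real ?A * indicator S u"
      using AE_iid_unif_unit[of ?n] AE_space
    proof eventually_elim
      case (elim u)
      then show ?case by (intro emb) auto
    qed
  qed (use int S_sets in auto)
  also have "\<dots> = real ?A * measure (iid_unif ?n) S"
    using S_sets sets.sets_into_space[OF S_sets] by (simp add: Int_absorb2)
  finally have "real ?A * measure (iid_unif ?n) S = fact ?n
      * labelled_density (\<lambda>k. card {p \<in> V. c p = k}) (c ` V) {1..l} x"
    using expected_embeddings_sample_graph(2)[OF w V, where n = ?n and c = c]
      real_card_injections[OF V, of ?n] by (simp add: F_def)
  moreover have "graphon_ind_density F (partite_graphon l x) = measure (iid_unif ?n) S"
    by (simp add: graphon_ind_density_def S_def F(2) Let_def)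
  ultimately show ?thesis using A by (simp add: field_simps)
qed

text \<open>
  If the weights \<open>x\<close> maximise the labelled density, both sequences of maximum densities eventually
  lie between \<open>L\<close> and \<open>L * n ^ card V / (n * (n - 1) * \<dots> * (n - card V + 1))\<close>, where \<open>L\<close> is the density in the
  graphon of \<open>x\<close>. The graphs giving the lower bound have no clique on more than \<open>t\<close> vertices.
\<close>

lemma inducibility_partite_graph:
  fixes c :: "'f \<Rightarrow> 'c"
  assumes V: "finite V" and w: "partite_weights t x"
    and opt: "\<And>(J :: nat set) y. finite J \<Longrightarrow> \<forall>j\<in>J. 0 \<le> y j \<Longrightarrow> (\<Sum>j\<in>J. y j) = 1 \<Longrightarrow>
      labelled_density (\<lambda>k. card {p \<in> V. c p = k}) (c ` V) J y
      \<le> labelled_density (\<lambda>k. card {p \<in> V. c p = k}) (c ` V) {1..t} x"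
  defines "F \<equiv> partite_graph V c"
  shows "inducibility F = graphon_ind_density F (partite_graphon t x)"
    and "t < k \<Longrightarrow> inducibility_free k F = graphon_ind_density F (partite_graphon t x)"
proof -
  let ?f = "card V"
  let ?A = "real (card (embeddings F F))"
  define D where "D = labelled_density (\<lambda>k. card {p \<in> V. c p = k}) (c ` V) {1..t} x"
  define L where "L = graphon_ind_density F (partite_graphon t x)"
  have F: "pair_graph F" "pverts F = V" using V by (simp_all add: F_def pair_graph_partite_graph)
  have A: "0 < ?A" using V F automorphisms_pos[of F] by simp
  have L: "L = fact ?f * D / ?A"
    unfolding L_def D_def F_def by (rule graphon_ind_density_partite[OF w V])
  have upper: "ind_density F G \<le> L * (real n ^ ?f / (fact ?f * real (n choose ?f)))"
    if G: "pair_graph G" "card (pverts G) = n" and n: "?f \<le> n" "1 \<le> n"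
    for G :: "nat pair_pre_digraph" and n
  proof -
    obtain d :: "nat \<Rightarrow> nat" where d: "d ` pverts G \<subseteq> pverts G"
      "card (embeddings F G) \<le> card (embeddings F (partite_graph (pverts G) d))"
      using ex_partite_graph_max_embeddings[OF G(1) V, of c] unfolding F_def by blast
    let ?y = "\<lambda>j. real (card {w \<in> pverts G. d w = j}) / real n"
    have W: "finite (pverts G)" "pverts G \<noteq> {}" using G n by (auto intro: card_ge_0_finite)
    have "(\<Sum>j\<in>pverts G. card {w \<in> pverts G. d w = j}) = card (pverts G)"
      using sum.group[OF W(1) W(1) d(1), of "\<lambda>_. 1 :: nat"] by simp
    then have "(\<Sum>j\<in>pverts G. ?y j) = 1"
      using G n by (simp add: sum_divide_distrib[symmetric] of_nat_sum[symmetric] del: of_nat_sum)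
    then have "labelled_density (\<lambda>k. card {p \<in> V. c p = k}) (c ` V) (pverts G) ?y \<le> D"
      unfolding D_def using W(1) by (intro opt) auto
    then have "real n ^ ?f * labelled_density (\<lambda>k. card {p \<in> V. c p = k}) (c ` V) (pverts G) ?y
        \<le> real n ^ ?f * D"
      by (intro mult_left_mono) auto
    moreover have "real (card (embeddings F G)) \<le> real (card (embeddings F (partite_graph (pverts G) d)))"
      using d(2) by simp
    ultimately have "real (card (embeddings F G)) \<le> real n ^ ?f * D"
      using card_embeddings_partite_le[OF V W(1) W(1) W(2) d(1), of c, unfolded G(2)]
      unfolding F_def by linarith
    then have "ind_density F G \<le> real n ^ ?f * D / (?A * real (n choose ?f))"
      unfolding ind_density_eq_embeddings[OF F(1) G(1)] F(2) G(2)
      by (intro divide_right_mono) auto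
    also have "\<dots> = L * (real n ^ ?f / (fact ?f * real (n choose ?f)))"
      unfolding L by (simp add: field_simps)
    finally show ?thesis .
  qed
  have lower: "\<exists>G :: nat pair_pre_digraph. pair_graph G \<and> card (pverts G) = n \<and> L \<le> ind_density F G
      \<and> (\<forall>k>t. clique_free k G)" if n: "?f \<le> n" for n
  proof -
    obtain d where d: "d ` {..<n} \<subseteq> {1..t}"
      "real (card (injections V {..<n})) * D \<le> real (card (embeddings F (partite_graph {..<n} d)))"
      using ex_sample_graph_many_embeddings[OF w V, of n c] unfolding D_def F_def by blast
    let ?G = "partite_graph {..<n} d"
    have G: "pair_graph ?G" by (rule pair_graph_partite_graph) simp
    have choose: "0 < real (n choose ?f)" using n by simp
    have "L = fact ?f * real (n choose ?f) * D / (?A * real (n choose ?f))"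
      unfolding L using choose by (simp add: field_simps)
    also have "\<dots> \<le> real (card (embeddings F ?G)) / (?A * real (n choose ?f))"
      using d(2) unfolding real_card_injections[OF V n] by (intro divide_right_mono) auto
    also have "\<dots> = ind_density F ?G"
      unfolding ind_density_eq_embeddings[OF F(1) G] F(2) by simp
    finally have "L \<le> ind_density F ?G" .
    moreover have "clique_free k ?G" if "t < k" for k
      using d(1) that by (intro clique_free_partite_graph[of _ "{1..t}"]) auto
    ultimately show ?thesis using G by (intro exI[of _ ?G]) auto
  qed
  have lim: "lim (\<lambda>n. Max {ind_density F G | G :: nat pair_pre_digraph.
        pair_graph G \<and> card (pverts G) = n \<and> Q G}) = L"
    if Q: "\<And>G :: nat pair_pre_digraph. (\<forall>k>t. clique_free k G) \<Longrightarrow> Q G" for Q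
  proof -
    let ?D = "\<lambda>n. {ind_density F G | G :: nat pair_pre_digraph.
        pair_graph G \<and> card (pverts G) = n \<and> Q G}"
    have ev: "eventually (\<lambda>n. ?f \<le> n \<and> 1 \<le> n) sequentially"
      using eventually_ge_at_top[of "max ?f 1"] by eventually_elim simp
    have "(\<lambda>n. Max (?D n)) \<longlonglongrightarrow> L"
    proof (rule tendsto_sandwich)
      show "eventually (\<lambda>n. L \<le> Max (?D n)) sequentially"
        using ev
      proof eventually_elim
        case (elim n)
        then obtain G :: "nat pair_pre_digraph" where G: "pair_graph G" "card (pverts G) = n"
          "L \<le> ind_density F G" "Q G" using lower[of n] Q by blast
        have "ind_density F G \<le> Max (?D n)"
          using G by (intro Max_ge[OF finite_densities]) blast
        then show ?case using G(3) by linarith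
      qed
      show "eventually (\<lambda>n. Max (?D n) \<le> L * (real n ^ ?f / (fact ?f * real (n choose ?f)))) sequentially"
        using ev
      proof eventually_elim
        case (elim n)
        have "?D n \<noteq> {}" using lower[of n] Q elim by blast
        then show ?case
          using upper elim by (intro Max.boundedI[OF finite_densities]) auto
      qed
      show "(\<lambda>n. L * (real n ^ ?f / (fact ?f * real (n choose ?f)))) \<longlonglongrightarrow> L"
        using tendsto_mult[OF tendsto_const tendsto_power_div_binomial[of ?f], of L] by simp
    qed simp
    then show ?thesis by (rule limI)
  qed
  show "inducibility F = graphon_ind_density F (partite_graphon t x)"
    using lim[of "\<lambda>_. True"] by (simp add: inducibility_def max_density_def L_def)
  show "inducibility_free k F = graphon_ind_density F (partite_graphon t x)" if "t < k"
    using lim[of "clique_free k"] that by (simp add: inducibility_free_def max_density_free_def L_def)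
qed

theorem theorem1p10:
  fixes r :: nat and a :: "nat \<Rightarrow> nat" and F :: "(nat \<times> nat) pair_pre_digraph"
  assumes "r \<ge> 2"
    and "\<And>i j. 1 \<le> i \<Longrightarrow> i \<le> j \<Longrightarrow> j \<le> r \<Longrightarrow> a j \<le> a i"
    and "a r \<ge> 1"
    and "F = complete_multipartite r a"
    and "a (r - 1) > 1"
  shows "(\<exists>t. (\<forall>k>t. attained_by_complete_partite (inducibility_free k F) F t)
              \<and> attained_by_complete_partite (inducibility F) F t)
         \<and> \<not> inducibility_diverse F"
proof -
  define V where "V = (SIGMA i:{1..r}. {1..a i})"
  define b where "b = (\<lambda>k. card {p \<in> V. fst p = k})"
  have V: "finite V" unfolding V_def by auto
  have F: "F = partite_graph V fst"
    by (auto simp: assms(4) complete_multipartite_def partite_graph_def Let_def V_def)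
  have pos: "1 \<le> a i" if "i \<in> {1..r}" for i using assms(2)[of i r] assms(3) that by auto
  have parts: "fst ` V = {1..r}" using pos by (force simp: V_def)
  have b: "b i = a i" if "i \<in> {1..r}" for i
  proof -
    have "{p \<in> V. fst p = i} = {i} \<times> {1..a i}" using that by (auto simp: V_def)
    then show ?thesis by (simp add: b_def card_cartesian_product)
  qed
  have "\<exists>t x. 1 \<le> t \<and> partite_weights t x \<and>
    (\<forall>(J :: nat set) y. finite J \<longrightarrow> (\<forall>j\<in>J. 0 \<le> y j) \<longrightarrow> (\<Sum>j\<in>J. y j) = 1 \<longrightarrow>
       labelled_density b {1..r} J y \<le> labelled_density b {1..r} {1..t} x)"
  \<comment> \<open>No part is smaller than the part \<open>r - 1\<close>, except possibly the last one.\<close>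
  proof (rule labelled_density_attains_max)
    show "r - 1 \<in> {1..r}" using assms(1) by auto
    then show "2 \<le> b (r - 1)" using assms(5) b by simp
    show "b (r - 1) \<le> b q \<or> b (r - 1) \<le> b q'" if "q \<in> {1..r}" "q' \<in> {1..r}" "q \<noteq> q'" for q q'
    proof -
      have "b (r - 1) \<le> b i" if "i \<in> {1..r}" "i \<noteq> r" for i
        using assms(2)[of i "r - 1"] that b[of i] b[of "r - 1"] assms(1) by auto
      then show ?thesis using that by metis
    qed
  qed (use pos b in auto)
  then obtain t x where t: "1 \<le> t" and x: "partite_weights t x" and
    opt: "\<And>(J :: nat set) y. finite J \<Longrightarrow> \<forall>j\<in>J. 0 \<le> y j \<Longrightarrow> (\<Sum>j\<in>J. y j) = 1 \<Longrightarrow>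
       labelled_density b {1..r} J y \<le> labelled_density b {1..r} {1..t} x"
    by blast
  note opt' = opt[unfolded b_def, folded parts]
  have i: "inducibility F = graphon_ind_density F (partite_graphon t x)"
    unfolding F by (rule inducibility_partite_graph(1)[OF V x opt'])
  have ik: "inducibility_free k F = graphon_ind_density F (partite_graphon t x)" if "t < k" for k
    unfolding F by (rule inducibility_partite_graph(2)[OF V x opt' that])
  have "\<not> inducibility_diverse F"
    unfolding inducibility_diverse_def using t ik by (auto intro!: exI[of _ "t + 1"])
  then show ?thesis
    using x i ik unfolding attained_by_complete_partite_def by metis
qed

end
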